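(* Let $E$ be a sequential effect space that has an invariant and invertibility preserving sequential product $\circ$ that is norm-continuous in its first argument. If $\circ'$ is an invertibility preserving sequential product on $E$ that is norm-continuous in its first argument, then $\circ=\circ'$.
   Context: Effect algebra: a set $E$ with elements $0,1$ and a partially defined operation $+$ that is commutative and associative (where defined: if $x+y$ is defined so is $y+x$ and they are equal; if $y+z$ and $x+(y+z)$ are defined then so are $x+y$ and $(x+y)+z$, and $x+(y+z)=(x+y)+z$), with $x+0=x$ always defined, such that $x+1$ defined implies $x=0$, and such that each $x$ has a unique $x^\perp$ with $x+x^\perp=1$. It is partially ordered by $x\leq y\iff\exists z: x+z=y$. A sequential product on an effect algebra $E$ is a total binary operation $\circ$ on $E$ such that, writing $a\mid b$ for $a\circ b=b\circ a$: (1) $a\circ(b+c)=a\circ b+a\circ c$ whenever $b+c$ is defined; (2) $1\circ a=a$; (3) $a\circ b=0\Rightarrow b\circ a=0$; (4) if $a\mid b$ then $a\mid b^\perp$ and $a\circ(b\circ c)=(a\circ b)\circ c$ for all $c$; (5) if $c\mid a$ and $c\mid b$ then $c\mid(a\circ b)$ and, if $a+b$ is defined, $c\mid(a+b)$. It is normal if for every descending sequence $a_1\geq a_2\geq\cdots$ with infimum $\bigwedge a_i$ we have $b\circ\bigwedge a_i=\bigwedge(b\circ a_i)$, and $b\mid a_i$ for all $i$ implies $b\mid\bigwedge a_i$. Convex effect algebra: an effect algebra with an action $[0,1]\times E\to E$ such that for $r,s\in[0,1]$: if $r+s\leq 1$ then $ra+sa$ is defined and equals $(r+s)a$; $(rs)a=r(sa)$;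 $0a=0$, $1a=a$; if $a+b$ is defined then $ra+rb$ is defined and equals $r(a+b)$. A sequential effect space (SES) is a convex effect algebra in which every descending sequence has an infimum and which has a normal sequential product. The sequential products $\circ,\circ'$ in the claim are sequential products on the underlying effect algebra and need not be normal. An order unit space $(V,C,1)$ is a real vector space with a proper cone $C$ ($C\cap(-C)=\{0\}$, $\mathrm{span}(C)=V$), ordered by $v\leq w\iff w-v\in C$, with an element $1$ such that every $v$ satisfies $-n1\leq v\leq n1$ for some $n\in\mathbb N$, and $v\leq\frac1n1$ for all $n\geq 1$ implies $v\leq 0$; its norm is $\|v\|=\inf\{r>0:-r1\leq v\leq r1\}$. Every SES $E$ is isomorphic, as a convex effect algebra, to the unit interval $[0,1]_V$ of an order unit space $V$, the associated order unit space; $E$ is identified with $[0,1]_V$. For $a\in E$ the map $b\mapsto a\circ b$ extends to a positive linear map on $V$; for $v\geq 0$, $v\neq 0$ in $V$ and $w\in V$ put $v\circ w=\|v\|\,\big((\|v\|^{-1}v)\circ w\big)$ (and similarly for $\circ'$). Norm-continuous in its first argument: for each fixed $b\in E$ the map $a\mapsto a\circ b$ is norm-continuous on $E$. Invariant: $\Phi(a\circ b)=\Phi(a)\circ\Phi(b)$ for all $a,b\in E$ and all unital order isomorphisms $\Phi:V\to V$ (linear bijections with $\Phi(1)=1$ and $v\geq0\iff\Phi(v)\geq 0$). A positive $b\in V$ is invertible if there is $c\geq 0$ in $V$ with $b\circ c=c\circ b=1$; then $b^{-1}:=c$. Invertibility preserving: for all positive invertible $a,b$ the product $a\circ b$ is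 invertible and $(a\circ b)^{-1}=a^{-1}\circ b^{-1}$. *)

theory Defs
  imports Complex_Main
begin

text \<open>
  An effect algebra is carried by a whole type; the partial addition takes values in an
  option type, so \<open>oplus x y = Some z\<close> reads ``\<open>x + y\<close> is defined and equals \<open>z\<close>''.
\<close>

locale effect_algebra =
  fixes oplus :: "'e \<Rightarrow> 'e \<Rightarrow> 'e option"
    and zero one :: 'e
  assumes oplus_comm: "oplus x y = Some z \<Longrightarrow> oplus y x = Some z"
    and oplus_assoc: "oplus y z = Some s \<Longrightarrow> oplus x s = Some t \<Longrightarrow>
          \<exists>r. oplus x y = Some r \<and> oplus r z = Some t"
    and oplus_zero: "oplus x zero = Some x"
    and oplus_one: "oplus x one \<noteq> None \<Longrightarrow> x = zero"
    and ex1_perp: "\<exists>!y. oplus x y = Some one"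

definition ea_perp :: "('e \<Rightarrow> 'e \<Rightarrow> 'e option) \<Rightarrow> 'e \<Rightarrow> 'e \<Rightarrow> 'e" where
  "ea_perp oplus one x = (THE y. oplus x y = Some one)"

definition ea_le :: "('e \<Rightarrow> 'e \<Rightarrow> 'e option) \<Rightarrow> 'e \<Rightarrow> 'e \<Rightarrow> bool" where
  "ea_le oplus x y \<longleftrightarrow> (\<exists>z. oplus x z = Some y)"

definition ea_descending :: "('e \<Rightarrow> 'e \<Rightarrow> 'e option) \<Rightarrow> (nat \<Rightarrow> 'e) \<Rightarrow> bool" where
  "ea_descending oplus a \<longleftrightarrow> (\<forall>n. ea_le oplus (a (Suc n)) (a n))"

definition ea_is_inf :: "('e \<Rightarrow> 'e \<Rightarrow> 'e option) \<Rightarrow> (nat \<Rightarrow> 'e) \<Rightarrow> 'e \<Rightarrow> bool" where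
  "ea_is_inf oplus a i \<longleftrightarrow>
     (\<forall>n. ea_le oplus i (a n)) \<and> (\<forall>l. (\<forall>n. ea_le oplus l (a n)) \<longrightarrow> ea_le oplus l i)"

definition commutes :: "('e \<Rightarrow> 'e \<Rightarrow> 'e) \<Rightarrow> 'e \<Rightarrow> 'e \<Rightarrow> bool" where
  "commutes sp a b \<longleftrightarrow> sp a b = sp b a"

locale sequential_product = effect_algebra oplus zero one
  for oplus :: "'e \<Rightarrow> 'e \<Rightarrow> 'e option" and zero one :: 'e +
  fixes sp :: "'e \<Rightarrow> 'e \<Rightarrow> 'e"
  assumes sp_additive: "oplus b c = Some d \<Longrightarrow> oplus (sp a b) (sp a c) = Some (sp a d)"
    and sp_one_left: "sp one a = a"
    and sp_zero_sym: "sp a b = zero \<Longrightarrow> sp b a = zero"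
    and commutes_perp: "commutes sp a b \<Longrightarrow> commutes sp a (ea_perp oplus one b)"
    and commutes_assoc: "commutes sp a b \<Longrightarrow> sp a (sp b c) = sp (sp a b) c"
    and commutes_sp: "commutes sp c a \<Longrightarrow> commutes sp c b \<Longrightarrow> commutes sp c (sp a b)"
    and commutes_oplus: "commutes sp c a \<Longrightarrow> commutes sp c b \<Longrightarrow> oplus a b = Some d \<Longrightarrow>
          commutes sp c d"

locale normal_sequential_product = sequential_product +
  assumes sp_inf: "ea_descending oplus a \<Longrightarrow> ea_is_inf oplus a i \<Longrightarrow>
          ea_is_inf oplus (\<lambda>n. sp b (a n)) (sp b i)"
    and commutes_inf: "ea_descending oplus a \<Longrightarrow> ea_is_inf oplus a i \<Longrightarrow>
          (\<And>n. commutes sp b (a n)) \<Longrightarrow> commutes sp b i"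

text \<open>The action is only constrained for scalars in the real unit interval.\<close>

locale convex_effect_algebra = effect_algebra oplus zero one
  for oplus :: "'e \<Rightarrow> 'e \<Rightarrow> 'e option" and zero one :: 'e +
  fixes scale :: "real \<Rightarrow> 'e \<Rightarrow> 'e"
  assumes scale_add_left: "0 \<le> r \<Longrightarrow> 0 \<le> s \<Longrightarrow> r + s \<le> 1 \<Longrightarrow>
          oplus (scale r a) (scale s a) = Some (scale (r + s) a)"
    and scale_scale: "0 \<le> r \<Longrightarrow> r \<le> 1 \<Longrightarrow> 0 \<le> s \<Longrightarrow> s \<le> 1 \<Longrightarrow>
          scale (r * s) a = scale r (scale s a)"
    and scale_zero: "scale 0 a = zero"
    and scale_one: "scale 1 a = a"
    and scale_add_right: "0 \<le> r \<Longrightarrow> r \<le> 1 \<Longrightarrow> oplus a b = Some c \<Longrightarrow>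
          oplus (scale r a) (scale r b) = Some (scale r c)"

locale sequential_effect_space = convex_effect_algebra +
  assumes ex_inf: "ea_descending oplus a \<Longrightarrow> \<exists>i. ea_is_inf oplus a i"
    and ex_normal_sp: "\<exists>sp. normal_sequential_product oplus zero one sp"

text \<open>
  The class \<open>ordered_real_vector\<close> supplies the proper cone, namely \<open>{v. 0 \<le> v}\<close>.
\<close>

locale order_unit_space =
  fixes u :: "'v::ordered_real_vector"
  assumes span_cone: "span {v :: 'v. 0 \<le> v} = UNIV"
    and order_unit: "\<exists>n::nat. - (real n *\<^sub>R u) \<le> v \<and> v \<le> real n *\<^sub>R u"
    and archimedean: "(\<And>n::nat. n \<ge> 1 \<Longrightarrow> v \<le> (1 / real n) *\<^sub>R u) \<Longrightarrow> v \<le> 0"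

definition ou_norm :: "'v::ordered_real_vector \<Rightarrow> 'v \<Rightarrow> real" where
  "ou_norm u v = Inf {r. 0 < r \<and> - (r *\<^sub>R u) \<le> v \<and> v \<le> r *\<^sub>R u}"

definition unital_order_iso :: "'v::ordered_real_vector \<Rightarrow> ('v \<Rightarrow> 'v) \<Rightarrow> bool" where
  "unital_order_iso u \<Phi> \<longleftrightarrow> linear \<Phi> \<and> bij \<Phi> \<and> \<Phi> u = u \<and> (\<forall>v. 0 \<le> v \<longleftrightarrow> 0 \<le> \<Phi> v)"

text \<open>
  An isomorphism \<open>\<phi>\<close> of convex effect algebras onto the unit interval of an order unit space,
  in which \<open>v + w\<close> is defined iff \<open>v + w \<le> u\<close>. As \<open>\<phi>\<close> is onto that interval, \<open>iso_oplus\<close>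
  covers definedness of the sum in both directions as well as its value.
\<close>

locale associated_order_unit_space =
  convex_effect_algebra oplus zero one scale + order_unit_space u
  for oplus :: "'e \<Rightarrow> 'e \<Rightarrow> 'e option" and zero one :: 'e and scale :: "real \<Rightarrow> 'e \<Rightarrow> 'e"
    and u :: "'v::ordered_real_vector" +
  fixes \<phi> :: "'e \<Rightarrow> 'v"
  assumes iso_bij: "bij_betw \<phi> UNIV {v. 0 \<le> v \<and> v \<le> u}"
    and iso_zero: "\<phi> zero = 0"
    and iso_one: "\<phi> one = u"
    and iso_oplus: "oplus x y = Some z \<longleftrightarrow> \<phi> x + \<phi> y = \<phi> z"
    and iso_scale: "0 \<le> r \<Longrightarrow> r \<le> 1 \<Longrightarrow> \<phi> (scale r x) = r *\<^sub>R \<phi> x"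

text \<open>
  In what follows \<open>\<phi>\<close> carries out the identification of the effect algebra with the unit interval.
  \<open>sp_ext \<phi> sp a\<close> is the linear extension to the whole space of \<open>b \<mapsto> sp a b\<close>; it is unique
  because the unit interval spans.
\<close>

definition sp_ext :: "('e \<Rightarrow> 'v::ordered_real_vector) \<Rightarrow> ('e \<Rightarrow> 'e \<Rightarrow> 'e) \<Rightarrow> 'e \<Rightarrow> 'v \<Rightarrow> 'v" where
  "sp_ext \<phi> sp a = (THE L. linear L \<and> (\<forall>b. L (\<phi> b) = \<phi> (sp a b)))"

text \<open>Meant for \<open>0 \<le> v\<close>; at \<open>v = 0\<close> the norm factor makes the value 0.\<close>

definition vprod ::
  "'v::ordered_real_vector \<Rightarrow> ('e \<Rightarrow> 'v) \<Rightarrow> ('e \<Rightarrow> 'e \<Rightarrow> 'e) \<Rightarrow> 'v \<Rightarrow> 'v \<Rightarrow> 'v" where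
  "vprod u \<phi> sp v w = ou_norm u v *\<^sub>R sp_ext \<phi> sp (inv \<phi> (inverse (ou_norm u v) *\<^sub>R v)) w"

definition norm_continuous_first ::
  "'v::ordered_real_vector \<Rightarrow> ('e \<Rightarrow> 'v) \<Rightarrow> ('e \<Rightarrow> 'e \<Rightarrow> 'e) \<Rightarrow> bool" where
  "norm_continuous_first u \<phi> sp \<longleftrightarrow>
     (\<forall>b a. \<forall>\<epsilon>>0. \<exists>\<delta>>0. \<forall>a'. ou_norm u (\<phi> a' - \<phi> a) < \<delta> \<longrightarrow>
        ou_norm u (\<phi> (sp a' b) - \<phi> (sp a b)) < \<epsilon>)"

definition invariant_sp ::
  "'v::ordered_real_vector \<Rightarrow> ('e \<Rightarrow> 'v) \<Rightarrow> ('e \<Rightarrow> 'e \<Rightarrow> 'e) \<Rightarrow> bool" where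
  "invariant_sp u \<phi> sp \<longleftrightarrow>
     (\<forall>\<Phi>. unital_order_iso u \<Phi> \<longrightarrow>
        (\<forall>a b. \<Phi> (\<phi> (sp a b)) = \<phi> (sp (inv \<phi> (\<Phi> (\<phi> a))) (inv \<phi> (\<Phi> (\<phi> b))))))"

definition is_sp_inverse ::
  "'v::ordered_real_vector \<Rightarrow> ('e \<Rightarrow> 'v) \<Rightarrow> ('e \<Rightarrow> 'e \<Rightarrow> 'e) \<Rightarrow> 'v \<Rightarrow> 'v \<Rightarrow> bool" where
  "is_sp_inverse u \<phi> sp b c \<longleftrightarrow> 0 \<le> c \<and> vprod u \<phi> sp b c = u \<and> vprod u \<phi> sp c b = u"

definition sp_invertible ::
  "'v::ordered_real_vector \<Rightarrow> ('e \<Rightarrow> 'v) \<Rightarrow> ('e \<Rightarrow> 'e \<Rightarrow> 'e) \<Rightarrow> 'v \<Rightarrow> bool" where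
  "sp_invertible u \<phi> sp b \<longleftrightarrow> 0 \<le> b \<and> (\<exists>c. is_sp_inverse u \<phi> sp b c)"

definition sp_inverse ::
  "'v::ordered_real_vector \<Rightarrow> ('e \<Rightarrow> 'v) \<Rightarrow> ('e \<Rightarrow> 'e \<Rightarrow> 'e) \<Rightarrow> 'v \<Rightarrow> 'v" where
  "sp_inverse u \<phi> sp b = (THE c. is_sp_inverse u \<phi> sp b c)"

definition invertibility_preserving ::
  "'v::ordered_real_vector \<Rightarrow> ('e \<Rightarrow> 'v) \<Rightarrow> ('e \<Rightarrow> 'e \<Rightarrow> 'e) \<Rightarrow> bool" where
  "invertibility_preserving u \<phi> sp \<longleftrightarrow>
     (\<forall>a b. sp_invertible u \<phi> sp a \<longrightarrow> sp_invertible u \<phi> sp b \<longrightarrow>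
        sp_invertible u \<phi> sp (vprod u \<phi> sp a b) \<and>
        sp_inverse u \<phi> sp (vprod u \<phi> sp a b) =
          vprod u \<phi> sp (sp_inverse u \<phi> sp a) (sp_inverse u \<phi> sp b))"

end

theory Submission
  imports Defs
begin

text \<open>
  In the unit interval of the associated order unit space, sharp elements and commutation with a
  sharp element are determined by the order alone, and every sequential product takes the same
  values on a sharp element and an element commuting with it. The normal product given by the
  sequential effect space writes every effect in binary with commuting sharp digits. Hence scalars
  are central for every sequential product, and two norm-continuous products have the same squares.
  By polarization they agree on elements lying in both bicommutants of a common element, and there
  one finds, by convergent iterations, inverses and square roots of every \<open>a \<ge> \<epsilon> 1\<close>.

  For such an \<open>a\<close>, the map \<open>\<Phi> b = a\<inverse> \<circ> (a \<circ>' b)\<close> is a unital order isomorphism with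
  \<open>a \<circ>' b = a \<circ> \<Phi> b\<close>. Preservation of inverses by both products and invariance of \<open>\<circ>\<close> show that the
  map attached to \<open>a\<inverse>\<close> is again \<open>\<Phi>\<close>, while invariance also shows that it is the inverse of \<open>\<Phi>\<close>. So
  \<open>\<Phi>\<close> is an involution, and the two products agree with \<open>a\<^sup>2\<close> on the left. Such squares are
  norm dense among the effects.
\<close>

section \<open>Order unit spaces\<close>

text \<open>The products to be compared are not assumed normal, so monotone limits cannot be taken
  inside them. Digits avoid this: sharpness and splitting along a sharp element are statements about
  the order, so digits found with one normal product serve every other product. A product is
  additive only in its second argument, so the digits of \<open>a\<close> decide
  \<open>a \<circ> a\<close> but say nothing about \<open>a \<circ> b\<close> for unrelated
  \<open>b\<close>; the passage to such \<open>b\<close> is what inverses and invariance are for.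
  Commutation with an element that is not sharp might differ between the two products, which
  confines polarization to both bicommutants at once. An involution \<open>\<Phi>\<close> need not
  be the identity, so the products are compared not at \<open>a\<close> but after applying
  \<open>a\<close> twice, where \<open>\<Phi>\<close> cancels; nothing is lost because every
  \<open>a \<ge> \<epsilon> 1\<close> is itself a square.\<close>

context order_unit_space
begin

lemma u_nonneg [simp]: "0 \<le> u"
proof -
  obtain n :: nat where "- (real n *\<^sub>R u) \<le> u"
    using order_unit by blast
  then have "0 \<le> (real n + 1) *\<^sub>R u"
    by (simp add: scaleR_left_distrib) (metis add.commute neg_le_iff_le diff_ge_0_iff_ge diff_minus_eq_add le_minus_iff)
  then have "0 \<le> inverse (real n + 1) *\<^sub>R ((real n + 1) *\<^sub>R u)"
    by (rule scaleR_nonneg_nonneg[rotated]) simp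
  then show ?thesis by simp
qed

lemma scaleR_u_mono: "r \<le> s \<Longrightarrow> r *\<^sub>R u \<le> s *\<^sub>R u"
  by (simp add: scaleR_right_mono u_nonneg)

lemma order_unit_real: "\<exists>r>0. - (r *\<^sub>R u) \<le> v \<and> v \<le> r *\<^sub>R u"
proof -
  obtain n :: nat where "- (real n *\<^sub>R u) \<le> v" "v \<le> real n *\<^sub>R u"
    using order_unit by blast
  moreover have "real n *\<^sub>R u \<le> (real n + 1) *\<^sub>R u"
    by (rule scaleR_u_mono) simp
  ultimately show ?thesis
    by (intro exI[of _ "real n + 1"]) (meson neg_le_iff_le of_nat_0_le_iff order_trans add_nonneg_pos zero_less_one)
qed

lemma archimedean_real:
  assumes "\<And>e. e > 0 \<Longrightarrow> v \<le> e *\<^sub>R u"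
  shows "v \<le> 0"
  by (rule archimedean) (simp add: assms)

lemma archimedean_eq_0:
  assumes "\<And>e. e > 0 \<Longrightarrow> - (e *\<^sub>R u) \<le> v \<and> v \<le> e *\<^sub>R u"
  shows "v = 0"
proof (rule antisym)
  show "v \<le> 0" by (rule archimedean_real) (use assms in blast)
  have "- v \<le> 0"
    by (rule archimedean_real) (use assms in \<open>metis minus_le_iff\<close>)
  then show "0 \<le> v" by simp
qed

lemma archimedean_multiples:
  assumes "\<And>n::nat. real n *\<^sub>R v \<le> u"
  shows "v \<le> 0"
proof (rule archimedean)
  fix n :: nat assume n: "n \<ge> 1"
  have "(1 / real n) *\<^sub>R (real n *\<^sub>R v) \<le> (1 / real n) *\<^sub>R u"
    by (rule scaleR_left_mono[OF assms]) simp
  then show "v \<le> (1 / real n) *\<^sub>R u" using n by simp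
qed

lemma ou_norm_le: "0 < r \<Longrightarrow> - (r *\<^sub>R u) \<le> v \<Longrightarrow> v \<le> r *\<^sub>R u \<Longrightarrow> ou_norm u v \<le> r"
  unfolding ou_norm_def by (rule cInf_lower) (auto intro: bdd_belowI[of _ 0])

lemma ou_norm_nonneg: "0 \<le> ou_norm u v"
  unfolding ou_norm_def using order_unit_real[of v] by (intro cInf_greatest) auto

lemma ou_norm_less_bounds:
  assumes "ou_norm u v < r"
  shows "- (r *\<^sub>R u) \<le> v" "v \<le> r *\<^sub>R u"
proof -
  obtain s where s: "s < r" "- (s *\<^sub>R u) \<le> v" "v \<le> s *\<^sub>R u"
    using assms order_unit_real[of v] unfolding ou_norm_def
    by (subst (asm) cInf_less_iff) (auto intro: bdd_belowI[of _ 0])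
  have "s *\<^sub>R u \<le> r *\<^sub>R u" using s by (intro scaleR_u_mono) simp
  with s show "- (r *\<^sub>R u) \<le> v" "v \<le> r *\<^sub>R u"
    by (meson neg_le_iff_le order_trans)+
qed

lemma le_ou_norm: "v \<le> ou_norm u v *\<^sub>R u"
proof -
  have "v - ou_norm u v *\<^sub>R u \<le> 0"
  proof (rule archimedean_real)
    fix e :: real assume "e > 0"
    then have "v \<le> (ou_norm u v + e) *\<^sub>R u" by (intro ou_norm_less_bounds) simp
    then show "v - ou_norm u v *\<^sub>R u \<le> e *\<^sub>R u"
      by (simp add: scaleR_left_distrib algebra_simps)
  qed
  then show ?thesis by simp
qed

lemma ou_norm_eq_0: "0 \<le> v \<Longrightarrow> ou_norm u v = 0 \<Longrightarrow> v = 0"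
  using le_ou_norm[of v] by (simp add: antisym)

lemma nonneg_bounded: "\<exists>r>0. r *\<^sub>R v \<le> u"
proof -
  obtain r where "r > 0" "v \<le> r *\<^sub>R u" using order_unit_real by blast
  then have "inverse r *\<^sub>R v \<le> inverse r *\<^sub>R (r *\<^sub>R u)"
    by (intro scaleR_left_mono) auto
  with \<open>r > 0\<close> show ?thesis by (intro exI[of _ "inverse r"]) auto
qed

lemma nonneg_scale_unit_interval:
  assumes "0 \<le> v" obtains r a where "r \<ge> 1" "a \<in> {0..u}" "v = r *\<^sub>R a"
proof -
  obtain r where r: "r > 0" "r *\<^sub>R v \<le> u" using nonneg_bounded by blast
  define s where "s = min r 1"
  have s: "s > 0" "s \<le> 1" using r s_def by auto
  have "s *\<^sub>R v \<le> r *\<^sub>R v" using assms s_def by (intro scaleR_right_mono) auto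
  with r have "s *\<^sub>R v \<le> u" by (meson order_trans)
  then show ?thesis using s assms
    by (intro that[of "inverse s" "s *\<^sub>R v"]) (auto simp: scaleR_nonneg_nonneg one_le_inverse)
qed

section \<open>Norm convergence, expressed by order bounds\<close>

definition conv :: "(nat \<Rightarrow> 'v) \<Rightarrow> 'v \<Rightarrow> bool" where
  "conv X x \<longleftrightarrow> (\<forall>e>0. \<exists>N. \<forall>n\<ge>N. - (e *\<^sub>R u) \<le> X n - x \<and> X n - x \<le> e *\<^sub>R u)"

lemma convD: "conv X x \<Longrightarrow> e > 0 \<Longrightarrow> \<exists>N. \<forall>n\<ge>N. - (e *\<^sub>R u) \<le> X n - x \<and> X n - x \<le> e *\<^sub>R u"
  by (simp add: conv_def)

lemma conv_const: "conv (\<lambda>n. x) x"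
  by (auto simp: conv_def scaleR_nonneg_nonneg u_nonneg)

lemma conv_add: assumes "conv X x" "conv Y y" shows "conv (\<lambda>n. X n + Y n) (x + y)"
  unfolding conv_def
proof (intro allI impI)
  fix e :: real assume "e > 0"
  then obtain N M where
    N: "\<And>n. n \<ge> N \<Longrightarrow> - ((e/2) *\<^sub>R u) \<le> X n - x \<and> X n - x \<le> (e/2) *\<^sub>R u" and
    M: "\<And>n. n \<ge> M \<Longrightarrow> - ((e/2) *\<^sub>R u) \<le> Y n - y \<and> Y n - y \<le> (e/2) *\<^sub>R u"
    using convD[OF assms(1), of "e/2"] convD[OF assms(2), of "e/2"] by auto
  have e: "(e/2) *\<^sub>R u + (e/2) *\<^sub>R u = e *\<^sub>R u"
    by (simp flip: scaleR_left_distrib)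
  show "\<exists>N. \<forall>n\<ge>N. - (e *\<^sub>R u) \<le> X n + Y n - (x + y) \<and> X n + Y n - (x + y) \<le> e *\<^sub>R u"
  proof (intro exI[of _ "max N M"] allI impI)
    fix n assume "n \<ge> max N M"
    then have n: "n \<ge> N" "n \<ge> M" by auto
    have "X n - x + (Y n - y) \<le> (e/2) *\<^sub>R u + (e/2) *\<^sub>R u"
      by (rule add_mono) (use N M n in auto)
    moreover have "- ((e/2) *\<^sub>R u) + - ((e/2) *\<^sub>R u) \<le> X n - x + (Y n - y)"
      by (rule add_mono) (use N M n in auto)
    ultimately show "- (e *\<^sub>R u) \<le> X n + Y n - (x + y) \<and> X n + Y n - (x + y) \<le> e *\<^sub>R u"
      unfolding e minus_add_distrib[symmetric] by (simp add: algebra_simps)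
  qed
qed

lemma conv_minus: assumes "conv X x" shows "conv (\<lambda>n. - X n) (- x)"
  unfolding conv_def
proof (intro allI impI)
  fix e :: real assume "e > 0"
  from convD[OF assms this] obtain N where
    N: "\<And>n. n \<ge> N \<Longrightarrow> - (e *\<^sub>R u) \<le> X n - x \<and> X n - x \<le> e *\<^sub>R u" by auto
  show "\<exists>N. \<forall>n\<ge>N. - (e *\<^sub>R u) \<le> - X n - - x \<and> - X n - - x \<le> e *\<^sub>R u"
  proof (intro exI[of _ N] allI impI)
    fix n assume "n \<ge> N"
    from N[OF this] show "- (e *\<^sub>R u) \<le> - X n - - x \<and> - X n - - x \<le> e *\<^sub>R u"
      by (metis add.inverse_inverse minus_diff_eq minus_diff_minus neg_le_iff_le)
  qed
qed

lemma conv_diff: "conv X x \<Longrightarrow> conv Y y \<Longrightarrow> conv (\<lambda>n. X n - Y n) (x - y)"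
  using conv_add[of X x "\<lambda>n. - Y n" "- y"] conv_minus[of Y y] by simp

lemma conv_unique: assumes "conv X x" "conv X y" shows "x = y"
proof -
  have c: "conv (\<lambda>n. X n - X n) (x - y)" by (rule conv_diff[OF assms])
  have "- (x - y) = 0"
  proof (rule archimedean_eq_0)
    fix e :: real assume "e > 0"
    from convD[OF c this] show "- (e *\<^sub>R u) \<le> - (x - y) \<and> - (x - y) \<le> e *\<^sub>R u" by auto
  qed
  then show ?thesis by simp
qed

lemma conv_Suc: "conv X x \<Longrightarrow> conv (\<lambda>n. X (Suc n)) x"
  unfolding conv_def by (meson le_Suc_eq)

lemma conv_real_bound:
  assumes "r \<longlonglongrightarrow> (0::real)" "\<And>n. - (r n *\<^sub>R u) \<le> X n - x" "\<And>n. X n - x \<le> r n *\<^sub>R u"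
  shows "conv X x"
  unfolding conv_def
proof (intro allI impI)
  fix e :: real assume "e > 0"
  then obtain N where N: "\<And>n. n \<ge> N \<Longrightarrow> r n < e"
    using order_tendstoD(2)[OF assms(1)] unfolding eventually_sequentially by blast
  show "\<exists>N. \<forall>n\<ge>N. - (e *\<^sub>R u) \<le> X n - x \<and> X n - x \<le> e *\<^sub>R u"
  proof (intro exI[of _ N] allI impI)
    fix n assume "n \<ge> N"
    then have "r n *\<^sub>R u \<le> e *\<^sub>R u" using N[of n] by (intro scaleR_u_mono) simp
    then show "- (e *\<^sub>R u) \<le> X n - x \<and> X n - x \<le> e *\<^sub>R u"
      using assms(2,3)[of n] by (meson neg_le_iff_le order_trans)
  qed
qed

text \<open>Positivity implies continuity: if \<open>L u \<le> r *\<^sub>R u\<close>, a bound by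
  \<open>e / r\<close> before \<open>L\<close> becomes a bound by \<open>e\<close> after it.\<close>

lemma conv_positive_linear:
  assumes "linear L" "\<And>w. 0 \<le> w \<Longrightarrow> 0 \<le> L w" "conv X x"
  shows "conv (\<lambda>n. L (X n)) (L x)"
  unfolding conv_def
proof (intro allI impI)
  fix e :: real assume e: "e > 0"
  interpret L: linear L by fact
  obtain r where r: "r > 0" "L u \<le> r *\<^sub>R u" using order_unit_real by blast
  have mono: "L v \<le> L w" if "v \<le> w" for v w
    using assms(2)[of "w - v"] that by (simp add: L.diff)
  from convD[OF assms(3), of "e / r"] e r obtain N where
    N: "\<And>n. n \<ge> N \<Longrightarrow> - ((e/r) *\<^sub>R u) \<le> X n - x \<and> X n - x \<le> (e/r) *\<^sub>R u" by auto
  have "(e/r) *\<^sub>R L u \<le> (e/r) *\<^sub>R (r *\<^sub>R u)"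
    using e r by (intro scaleR_left_mono) auto
  then have le: "(e/r) *\<^sub>R L u \<le> e *\<^sub>R u" using r by simp
  show "\<exists>N. \<forall>n\<ge>N. - (e *\<^sub>R u) \<le> L (X n) - L x \<and> L (X n) - L x \<le> e *\<^sub>R u"
  proof (intro exI[of _ N] allI impI)
    fix n assume "n \<ge> N"
    from N[OF this] have "L (- ((e/r) *\<^sub>R u)) \<le> L (X n - x)" "L (X n - x) \<le> L ((e/r) *\<^sub>R u)"
      by (auto intro: mono)
    then have "- ((e/r) *\<^sub>R L u) \<le> L (X n) - L x" "L (X n) - L x \<le> (e/r) *\<^sub>R L u"
      by (simp_all only: L.diff L.neg L.scaleR)
    with le show "- (e *\<^sub>R u) \<le> L (X n) - L x \<and> L (X n) - L x \<le> e *\<^sub>R u"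
      by (meson neg_le_iff_le order_trans)
  qed
qed

lemma conv_nonneg: assumes "conv X x" "\<And>n. 0 \<le> X n" shows "0 \<le> x"
proof -
  have "- x \<le> 0"
  proof (rule archimedean_real)
    fix e :: real assume "e > 0"
    from convD[OF assms(1) this] obtain n where "X n - x \<le> e *\<^sub>R u" by blast
    with assms(2)[of n] show "- x \<le> e *\<^sub>R u"
      using order_trans[of "- x" "X n - x"] by simp
  qed
  then show ?thesis by simp
qed

lemma linear_eq_on_interval:
  fixes f g :: "'v \<Rightarrow> 'v"
  assumes "linear f" "linear g" "\<And>a. a \<in> {0..u} \<Longrightarrow> f a = g a"
  shows "f = g"
proof
  fix w
  interpret f: linear f by fact
  interpret g: linear g by fact
  have pos: "f v = g v" if v: "0 \<le> v" for v
  proof -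
    obtain r a where "a \<in> {0..u}" "v = r *\<^sub>R a" using nonneg_scale_unit_interval[OF v] by metis
    then show ?thesis using assms(3)[of a] by (simp add: f.scaleR g.scaleR)
  qed
  obtain r where r: "r > 0" "- (r *\<^sub>R u) \<le> w" using order_unit_real by blast
  then have "0 \<le> w + r *\<^sub>R u" by (metis add.commute diff_ge_0_iff_ge diff_minus_eq_add)
  moreover have "0 \<le> r *\<^sub>R u" using r u_nonneg by (simp add: scaleR_nonneg_nonneg)
  ultimately have "f (w + r *\<^sub>R u) - f (r *\<^sub>R u) = g (w + r *\<^sub>R u) - g (r *\<^sub>R u)"
    using pos by simp
  then show "f w = g w" by (simp add: f.add g.add)
qed

end

section \<open>Products on the unit interval and sharp elements\<close>

context order_unit_space
begin

abbreviation E :: "'v set" where "E \<equiv> {0..u}"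

text \<open>The order form of \<open>P p (u - p) = 0\<close> (\<open>sharpI\<close>,
  \<open>sharpD\<close>). No product occurs in it, so the sharp elements are the same for all
  products.\<close>

definition sharp :: "'v \<Rightarrow> bool" where
  "sharp p \<longleftrightarrow> p \<in> E \<and> (\<forall>x. 0 \<le> x \<longrightarrow> x \<le> p \<longrightarrow> x \<le> u - p \<longrightarrow> x = 0)"

text \<open>For sharp \<open>p\<close> this is the order form of commuting with \<open>p\<close>
  (\<open>splits_comm\<close>, \<open>comm_splits\<close>), again without mention of a
  product.\<close>

definition splits :: "'v \<Rightarrow> 'v \<Rightarrow> bool" where
  "splits p a \<longleftrightarrow> (\<exists>x y. 0 \<le> x \<and> x \<le> p \<and> 0 \<le> y \<and> y \<le> u - p \<and> a = x + y)"

lemma zero_in_E [simp]: "0 \<in> E" and u_in_E [simp]: "u \<in> E"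
  by (simp_all add: u_nonneg)

lemma compl_in_E: "a \<in> E \<Longrightarrow> u - a \<in> E"
  by simp

lemma scale_in_E:
  assumes "0 \<le> t" "t \<le> 1" "a \<in> E" shows "t *\<^sub>R a \<in> E"
proof -
  have "t *\<^sub>R a \<le> 1 *\<^sub>R a" using assms by (intro scaleR_right_mono) auto
  then have "t *\<^sub>R a \<le> u" using assms by (metis atLeastAtMost_iff order_trans scaleR_one)
  then show ?thesis using assms by (auto simp: scaleR_nonneg_nonneg)
qed

end

text \<open>A sequential product read on the unit interval. \<open>P\<close> is total on the space,
  but nothing is prescribed outside \<open>E\<close>, and neither additivity nor homogeneity is
  assumed in the first argument.\<close>

locale ou_product = order_unit_space u for u :: "'v::ordered_real_vector" +
  fixes P :: "'v \<Rightarrow> 'v \<Rightarrow> 'v"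
  assumes closed: "a \<in> E \<Longrightarrow> b \<in> E \<Longrightarrow> P a b \<in> E"
    and add_right: "a \<in> E \<Longrightarrow> b \<in> E \<Longrightarrow> c \<in> E \<Longrightarrow> b + c \<in> E \<Longrightarrow> P a (b + c) = P a b + P a c"
    and unit_left: "a \<in> E \<Longrightarrow> P u a = a"
    and zero_sym: "a \<in> E \<Longrightarrow> b \<in> E \<Longrightarrow> P a b = 0 \<Longrightarrow> P b a = 0"
    and comm_compl: "a \<in> E \<Longrightarrow> b \<in> E \<Longrightarrow> P a b = P b a \<Longrightarrow> P a (u - b) = P (u - b) a"
    and assoc: "a \<in> E \<Longrightarrow> b \<in> E \<Longrightarrow> c \<in> E \<Longrightarrow> P a b = P b a \<Longrightarrow> P a (P b c) = P (P a b) c"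
    and comm_mult: "a \<in> E \<Longrightarrow> b \<in> E \<Longrightarrow> c \<in> E \<Longrightarrow> P c a = P a c \<Longrightarrow> P c b = P b c \<Longrightarrow>
          P c (P a b) = P (P a b) c"
    and comm_add: "a \<in> E \<Longrightarrow> b \<in> E \<Longrightarrow> c \<in> E \<Longrightarrow> a + b \<in> E \<Longrightarrow> P c a = P a c \<Longrightarrow> P c b = P b c \<Longrightarrow>
          P c (a + b) = P (a + b) c"
begin

lemma nonneg: "a \<in> E \<Longrightarrow> b \<in> E \<Longrightarrow> 0 \<le> P a b"
  using closed by simp

lemma zero_right: "a \<in> E \<Longrightarrow> P a 0 = 0"
  using add_right[of a 0 0] by simp

lemma zero_left: "a \<in> E \<Longrightarrow> P 0 a = 0"
  using zero_sym[of a 0] zero_right[of a] by simp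

text \<open>Zero commutes with \<open>a\<close>, hence so does its complement
  \<open>u\<close>.\<close>

lemma unit_right: "a \<in> E \<Longrightarrow> P a u = a"
  using comm_compl[of a 0] unit_left[of a] zero_right[of a] zero_left[of a] by simp

lemma diff_right:
  assumes "a \<in> E" "b \<in> E" "c \<in> E" "c \<le> b"
  shows "P a (b - c) = P a b - P a c"
proof -
  have "b - c \<in> E" using assms by (auto intro: order_trans[of _ b])
  then show ?thesis using add_right[of a "b - c" c] assms by simp
qed

lemma compl_right: "a \<in> E \<Longrightarrow> b \<in> E \<Longrightarrow> P a (u - b) = a - P a b"
  using diff_right[of a u b] by (simp add: unit_right)

lemma mono_right:
  assumes "a \<in> E" "b \<in> E" "c \<in> E" "b \<le> c" shows "P a b \<le> P a c"
proof -
  have "c - b \<in> E" using assms by (auto intro: order_trans[of _ c])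
  then show ?thesis using diff_right[of a c b] nonneg[of a "c - b"] assms by simp
qed

lemma le_left: "a \<in> E \<Longrightarrow> b \<in> E \<Longrightarrow> P a b \<le> a"
  using mono_right[of a b u] by (simp add: unit_right)

text \<open>Additivity settles the fractions \<open>k / M\<close>, monotonicity traps
  \<open>t\<close> between two neighbouring ones, and the archimedean axiom closes the gap.\<close>

lemma scale_right:
  assumes a: "a \<in> E" and b: "b \<in> E" and t: "0 \<le> t" "t \<le> 1"
  shows "P a (t *\<^sub>R b) = t *\<^sub>R P a b"
proof (cases "t = 1")
  case False
  have sc: "s *\<^sub>R b \<in> E" if "0 \<le> s" "s \<le> 1" for s using scale_in_E that b by blast
  have mult: "P a ((real k * s) *\<^sub>R b) = real k *\<^sub>R P a (s *\<^sub>R b)"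
    if "0 \<le> s" "real k * s \<le> 1" for k s
    using that
  proof (induction k)
    case 0 then show ?case using a by (simp add: zero_right)
  next
    case (Suc k)
    have 1: "real k * s \<le> 1" "s \<le> 1" using Suc.prems
      using mult_nonneg_nonneg[OF of_nat_0_le_iff Suc.prems(1), of k]
      unfolding of_nat_Suc distrib_right by linarith+
    have "P a ((real k * s) *\<^sub>R b + s *\<^sub>R b) = P a ((real k * s) *\<^sub>R b) + P a (s *\<^sub>R b)"
      using Suc.prems 1 sc[of "real (Suc k) * s"]
      by (intro add_right a sc) (auto simp: scaleR_left_distrib distrib_right add.commute)
    then show ?case using Suc 1 by (simp add: distrib_right scaleR_left_distrib add.commute)
  qed
  have "P a (t *\<^sub>R b) - t *\<^sub>R P a b = 0"
  proof (rule archimedean_eq_0)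
    fix e :: real assume "e > 0"
    then obtain N where N: "inverse (real (Suc N)) < e" using reals_Archimedean by blast
    define M where "M = real (Suc N)"
    have M: "M > 0" "1 / M < e" using N by (auto simp: M_def inverse_eq_divide)
    define k where "k = nat \<lfloor>t * M\<rfloor>"
    have k: "real k \<le> t * M" "t * M < real k + 1"
      using t M by (auto simp: k_def)
    \<comment> \<open>The case \<open>t = 1\<close> was split off so that the upper neighbour
      \<open>(k + 1) / M\<close> is still at most 1, as membership in \<open>E\<close>
      demands.\<close>
    have tM: "t * M < M" using False t M by simp
    have "real k < M" using k tM by linarith
    then have kM: "real k + 1 \<le> M" by (simp add: M_def)
    have g1: "P a b = M *\<^sub>R P a ((1 / M) *\<^sub>R b)"
      using mult[of "1 / M" "Suc N"] M unfolding M_def[symmetric] by simp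
    have gl: "P a ((real l / M) *\<^sub>R b) = (real l / M) *\<^sub>R P a b" if "real l \<le> M" for l
      using mult[of "1 / M" l] M that g1 by simp
    have le1: "real k / M \<le> t" "t \<le> real (Suc k) / M" "real (Suc k) / M \<le> 1"
      using k M kM by (auto simp: field_simps)
    have b0: "0 \<le> b" and Pb: "0 \<le> P a b" "P a b \<le> u" using b closed[OF a b] by auto
    have "P a ((real k / M) *\<^sub>R b) \<le> P a (t *\<^sub>R b)"
      using le1 t b0 M by (intro mono_right a sc scaleR_right_mono) auto
    moreover have "P a (t *\<^sub>R b) \<le> P a ((real (Suc k) / M) *\<^sub>R b)"
      using le1 t b0 M by (intro mono_right a sc scaleR_right_mono) auto
    ultimately have
      1: "(real k / M) *\<^sub>R P a b \<le> P a (t *\<^sub>R b)" "P a (t *\<^sub>R b) \<le> (real (Suc k) / M) *\<^sub>R P a b"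
      using gl[of k] gl[of "Suc k"] kM by auto
    have "(real (Suc k) / M) *\<^sub>R P a b - t *\<^sub>R P a b = (real (Suc k) / M - t) *\<^sub>R P a b"
      by (simp add: scaleR_left_diff_distrib)
    also have "\<dots> \<le> e *\<^sub>R P a b"
      using k M Pb by (intro scaleR_right_mono) (auto simp: field_simps)
    also have "\<dots> \<le> e *\<^sub>R u" using Pb \<open>e > 0\<close> by (intro scaleR_left_mono) auto
    finally have 2: "(real (Suc k) / M) *\<^sub>R P a b - t *\<^sub>R P a b \<le> e *\<^sub>R u" .
    have "t *\<^sub>R P a b - (real k / M) *\<^sub>R P a b = (t - real k / M) *\<^sub>R P a b"
      by (simp add: scaleR_left_diff_distrib)
    also have "\<dots> \<le> e *\<^sub>R P a b"
      using k M Pb by (intro scaleR_right_mono) (auto simp: field_simps)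
    also have "\<dots> \<le> e *\<^sub>R u" using Pb \<open>e > 0\<close> by (intro scaleR_left_mono) auto
    finally have 3: "t *\<^sub>R P a b - (real k / M) *\<^sub>R P a b \<le> e *\<^sub>R u" .
    have "P a (t *\<^sub>R b) - t *\<^sub>R P a b \<le> e *\<^sub>R u"
      using order_trans[OF diff_right_mono[OF 1(2)] 2] .
    moreover have "t *\<^sub>R P a b - P a (t *\<^sub>R b) \<le> e *\<^sub>R u"
      using order_trans[OF diff_left_mono[OF 1(1)] 3] .
    then have "- (e *\<^sub>R u) \<le> P a (t *\<^sub>R b) - t *\<^sub>R P a b"
      by (subst minus_le_iff) (simp only: minus_diff_eq)
    ultimately show "- (e *\<^sub>R u) \<le> P a (t *\<^sub>R b) - t *\<^sub>R P a b \<and> P a (t *\<^sub>R b) - t *\<^sub>R P a b \<le> e *\<^sub>R u"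
      by blast
  qed
  then show ?thesis by simp
qed simp

text \<open>The complement of \<open>a - b\<close> is \<open>(u - a) + b\<close>, so closure under
  complements and sums is enough.\<close>

lemma comm_diff:
  assumes "a \<in> E" "b \<in> E" "c \<in> E" "b \<le> a" "P c a = P a c" "P c b = P b c"
  shows "P c (a - b) = P (a - b) c"
proof -
  have E: "u - a + b \<in> E" using assms
    using add_nonneg_nonneg[of "u - a" b] add_left_mono[of b a "u - a"] by simp
  then have "P c ((u - a) + b) = P ((u - a) + b) c"
    using assms by (intro comm_add) (auto intro: comm_compl)
  then have "P c (u - (u - a + b)) = P (u - (u - a + b)) c"
    using E assms by (intro comm_compl) auto
  then show ?thesis by simp
qed

text \<open>An \<open>x\<close> below both \<open>p\<close> and \<open>u - p\<close> is annihilated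
  by both from the left. By \<open>zero_sym\<close> it annihilates both in turn, hence also their
  sum \<open>u\<close>, and \<open>P x u = x\<close>.\<close>

lemma sharpI:
  assumes p: "p \<in> E" and "P p (u - p) = 0"
  shows "sharp p"
  unfolding sharp_def
proof (intro conjI allI impI)
  fix x assume x: "0 \<le> x" "x \<le> p" "x \<le> u - p"
  have xE: "x \<in> E" using x p by auto
  have 0: "P (u - p) p = 0" using zero_sym[of p "u - p"] assms by simp
  have "P p x \<le> 0" using mono_right[of p x "u - p"] x xE assms by simp
  then have "P p x = 0" using nonneg[OF p xE] by simp
  moreover have "P (u - p) x \<le> 0" using mono_right[of "u - p" x p] x xE p 0 by simp
  then have "P (u - p) x = 0" using nonneg[of "u - p" x] p xE by simp
  ultimately have "P x p = 0" "P x (u - p) = 0"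
    using zero_sym p xE by auto
  then show "x = 0" using compl_right[OF xE p] by simp
qed (use p in simp)

text \<open>As \<open>p\<close> commutes with \<open>u - p\<close>, their product lies below both of
  them.\<close>

lemma sharpD:
  assumes "sharp p" shows "P p (u - p) = 0"
proof -
  have p: "p \<in> E" using assms sharp_def by blast
  then have "P p (u - p) = P (u - p) p" by (intro comm_compl) auto
  then have "P p (u - p) \<le> p" "P p (u - p) \<le> u - p"
    using le_left[of p "u - p"] le_left[of "u - p" p] p by auto
  then show ?thesis using nonneg[of p "u - p"] p assms unfolding sharp_def by simp
qed

lemma sharp_compl: "sharp p \<Longrightarrow> sharp (u - p)"
  unfolding sharp_def by simp

text \<open>\<open>u - p\<close> annihilates \<open>p\<close>, hence everything below
  \<open>p\<close>; \<open>zero_sym\<close> reverses the factors, so \<open>a\<close> commutes with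
  \<open>u - p\<close> and with its complement \<open>p\<close>.\<close>

lemma below_sharp:
  assumes p: "sharp p" and a: "0 \<le> a" "a \<le> p"
  shows "P p a = a" "P a p = a" "P (u - p) a = 0"
proof -
  have E: "p \<in> E" "a \<in> E" using p a by (auto simp: sharp_def)
  have "P (u - p) p = 0" using sharpD[OF p] zero_sym E by simp
  then have "P (u - p) a \<le> 0" using mono_right[of "u - p" a p] E a by simp
  then show 0: "P (u - p) a = 0" using nonneg[of "u - p" a] E by simp
  then have 1: "P a (u - p) = 0" using zero_sym E by simp
  then show "P a p = a" using compl_right[of a p] E by simp
  have "P a (u - (u - p)) = P (u - (u - p)) a"
    by (rule comm_compl) (use 0 1 E in auto)
  then show "P p a = a" using \<open>P a p = a\<close> by simp
qed

lemma splits_comm: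
  assumes p: "sharp p" and a: "splits p a" "a \<in> E"
  shows "P p a = P a p"
proof -
  obtain x y where xy: "0 \<le> x" "x \<le> p" "0 \<le> y" "y \<le> u - p" "a = x + y"
    using a splits_def by blast
  have E: "p \<in> E" using p sharp_def by blast
  have xyE: "x \<in> E" "y \<in> E" using xy E by (auto intro: order_trans[of y "u - p"])
  have "P p x = P x p" using below_sharp[OF p xy(1,2)] by simp
  moreover have "P (u - p) y = P y (u - p)" using below_sharp[OF sharp_compl[OF p] xy(3,4)] by simp
  then have "P p y = P y p" using comm_compl[of y "u - p"] E xyE by simp
  ultimately show ?thesis using comm_add[of x y p] E xyE a xy by simp
qed

text \<open>The right-hand side does not involve \<open>P\<close>: any two products agree on a sharp
  element and an element that splits along it.\<close>

lemma splits_value: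
  assumes p: "sharp p" and xy: "0 \<le> x" "x \<le> p" "0 \<le> y" "y \<le> u - p"
  shows "P p (x + y) = x"
proof -
  have E: "p \<in> E" using p sharp_def by blast
  have xyE: "x \<in> E" "y \<in> E" using xy E by (auto intro: order_trans[of y "u - p"])
  have "x + y \<in> E" using xy add_mono[OF xy(2,4)] by auto
  then show ?thesis using add_right[of p x y] E xyE below_sharp(1)[OF p xy(1,2)]
     below_sharp(3)[OF sharp_compl[OF p] xy(3,4)] by simp
qed

text \<open>Additivity gives \<open>a = P a p + P a (u - p)\<close>; after commuting, the two terms
  are \<open>P p a\<close> and \<open>P (u - p) a\<close>, bounded by their first factors.\<close>

lemma comm_splits:
  assumes p: "p \<in> E" and a: "a \<in> E" "P p a = P a p"
  shows "splits p a"
proof -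
  have "P a (u - p) = P (u - p) a" using comm_compl[of a p] p a by simp
  moreover have "a = P a p + P a (u - p)" using compl_right[of a p] p a by simp
  ultimately have "a = P p a + P (u - p) a" using a by simp
  then show ?thesis unfolding splits_def
    using nonneg[of p a] nonneg[of "u - p" a] le_left[of p a] le_left[of "u - p" a] p a
    by (intro exI[of _ "P p a"] exI[of _ "P (u - p) a"]) auto
qed

end

section \<open>Binary digits in a normal sequential product\<close>

context order_unit_space
begin

text \<open>Lower bounds range over the whole space and not only over \<open>E\<close>, which makes
  infima invariant under translation; \<open>relative_inf_is_inf\<close> shows how infima within
  \<open>E\<close> acquire this property.\<close>

definition is_inf :: "(nat \<Rightarrow> 'v) \<Rightarrow> 'v \<Rightarrow> bool" where
  "is_inf X i \<longleftrightarrow> (\<forall>n. i \<le> X n) \<and> (\<forall>l. (\<forall>n. l \<le> X n) \<longrightarrow> l \<le> i)"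

lemma is_inf_lower: "is_inf X i \<Longrightarrow> i \<le> X n"
  and is_inf_greatest: "is_inf X i \<Longrightarrow> (\<And>n. l \<le> X n) \<Longrightarrow> l \<le> i"
  by (auto simp: is_inf_def)

lemma is_inf_unique: "is_inf X i \<Longrightarrow> is_inf X j \<Longrightarrow> i = j"
  by (meson antisym is_inf_def)

lemma is_inf_const: "is_inf (\<lambda>n. c) c"
  by (simp add: is_inf_def)

lemma is_inf_shift: assumes "is_inf X i" shows "is_inf (\<lambda>n. X n + c) (i + c)"
  unfolding is_inf_def
proof (intro conjI allI impI)
  fix l assume "\<forall>n. l \<le> X n + c"
  then have "l - c \<le> i" by (intro is_inf_greatest[OF assms]) (simp add: diff_le_eq)
  then show "l \<le> i + c" by (simp add: diff_le_eq)
qed (simp add: is_inf_lower[OF assms])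

lemma is_inf_Suc: assumes "is_inf X i" "decseq X" shows "is_inf (\<lambda>n. X (Suc n)) i"
  unfolding is_inf_def
proof (intro conjI allI impI)
  fix l assume l: "\<forall>n. l \<le> X (Suc n)"
  have "l \<le> X n" for n using l decseq_SucD[OF assms(2), of n] by (auto intro: order_trans)
  then show "l \<le> i" by (rule is_inf_greatest[OF assms(1)])
qed (rule is_inf_lower[OF assms(1)])

text \<open>The sharp elements \<open>p n\<close> are the binary digits of \<open>a\<close>, and \<open>b n\<close> is its \<open>n\<close>-th binary shift.\<close>

definition dyadic :: "'v \<Rightarrow> bool" where
  "dyadic a \<longleftrightarrow> (\<exists>p b. b 0 = a \<and> (\<forall>n. b n \<in> E \<and> sharp (p n) \<and> 2 *\<^sub>R b n = p n + b (Suc n)) \<and>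
     (\<forall>m n. splits (p m) (p n)))"

end

locale normal_ou_product = ou_product u P
  for u :: "'v::ordered_real_vector" and P :: "'v \<Rightarrow> 'v \<Rightarrow> 'v" +
  assumes ex_inf: "(\<And>n. X n \<in> E) \<Longrightarrow> decseq X \<Longrightarrow> \<exists>i. is_inf X i"
    and inf_mult: "(\<And>n. X n \<in> E) \<Longrightarrow> decseq X \<Longrightarrow> is_inf X i \<Longrightarrow> b \<in> E \<Longrightarrow> is_inf (\<lambda>n. P b (X n)) (P b i)"
    and inf_comm: "(\<And>n. X n \<in> E) \<Longrightarrow> decseq X \<Longrightarrow> is_inf X i \<Longrightarrow> b \<in> E \<Longrightarrow>
          (\<And>n. P b (X n) = P (X n) b) \<Longrightarrow> P b i = P i b"
begin

text \<open>It serves as the commutative algebra generated by \<open>a\<close>: any two members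
  commute (\<open>bic_commute\<close>), and it is closed under complements, products, bounded sums
  and infima of descending sequences.\<close>

definition bicommutant :: "'v \<Rightarrow> 'v set" where
  "bicommutant a = {c \<in> E. \<forall>x\<in>E. P x a = P a x \<longrightarrow> P x c = P c x}"

lemma bic_E: "c \<in> bicommutant a \<Longrightarrow> c \<in> E"
  by (simp add: bicommutant_def)

lemma bic_self: "a \<in> E \<Longrightarrow> a \<in> bicommutant a"
  by (simp add: bicommutant_def)

lemma bic_unit: "u \<in> bicommutant a"
  by (simp add: bicommutant_def unit_left unit_right)

lemma bic_compl: "c \<in> bicommutant a \<Longrightarrow> u - c \<in> bicommutant a"
  unfolding bicommutant_def by (auto intro: comm_compl)

lemma bic_mult: "c \<in> bicommutant a \<Longrightarrow> d \<in> bicommutant a \<Longrightarrow> P c d \<in> bicommutant a"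
  unfolding bicommutant_def using closed by (auto intro: comm_mult)

lemma bic_add: "c \<in> bicommutant a \<Longrightarrow> d \<in> bicommutant a \<Longrightarrow> c + d \<le> u \<Longrightarrow> c + d \<in> bicommutant a"
  unfolding bicommutant_def by (auto intro: comm_add)

lemma bic_inf:
  assumes "\<And>n. X n \<in> bicommutant a" "decseq X" "is_inf X i"
  shows "i \<in> bicommutant a"
proof -
  have X: "X n \<in> E" for n using assms(1) bic_E by blast
  have "0 \<le> i" using X by (intro is_inf_greatest[OF assms(3)]) simp
  moreover have "i \<le> u" using is_inf_lower[OF assms(3), of 0] X[of 0] by auto
  ultimately show ?thesis
    using inf_comm[OF X assms(2,3)] assms(1) by (simp add: bicommutant_def)
qed

lemma bic_comm: "c \<in> bicommutant a \<Longrightarrow> x \<in> E \<Longrightarrow> P x a = P a x \<Longrightarrow> P x c = P c x"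
  by (simp add: bicommutant_def)

text \<open>\<open>a\<close> commutes with itself, so \<open>c\<close> commutes with
  \<open>a\<close>, and therefore \<open>d\<close> commutes with \<open>c\<close>.\<close>

lemma bic_commute:
  assumes "a \<in> E" "c \<in> bicommutant a" "d \<in> bicommutant a"
  shows "P c d = P d c"
proof -
  have "P c a = P a c" using bic_comm[OF assms(2,1)] by simp
  then show ?thesis using bic_comm[OF assms(3) bic_E[OF assms(2)]] by simp
qed

lemma bic_trans: "c \<in> bicommutant a \<Longrightarrow> d \<in> bicommutant c \<Longrightarrow> d \<in> bicommutant a"
  by (simp add: bicommutant_def)

primrec pow :: "'v \<Rightarrow> nat \<Rightarrow> 'v" where
  "pow a 0 = u" | "pow a (Suc n) = P a (pow a n)"

text \<open>\<open>u - p\<close> is the infimum of the powers of \<open>u - \<alpha>\<close>.\<close>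

lemma bic_support:
  assumes a: "a \<in> E" and al: "\<alpha> \<in> bicommutant a" and be: "\<beta> \<in> bicommutant a" and 0: "P \<alpha> \<beta> = 0"
  obtains p where "p \<in> bicommutant a" "sharp p" "\<alpha> \<le> p" "\<beta> \<le> u - p"
proof -
  define b where "b = u - \<alpha>"
  have b: "b \<in> bicommutant a" unfolding b_def by (rule bic_compl[OF al])
  define X where "X = pow b"
  have X: "X n \<in> bicommutant a" for n
    unfolding X_def by (induction n) (simp_all add: bic_unit bic_mult b)
  have XE: "X n \<in> E" for n using X bic_E by blast
  have bE: "b \<in> E" and beE: "\<beta> \<in> E" and alE: "\<alpha> \<in> E" using b be al bic_E by auto
  have XS: "X (Suc n) = P b (X n)" for n by (simp add: X_def)
  have dec: "decseq X"
    unfolding decseq_Suc_iff XS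
    using bic_commute[OF a b X] le_left[OF XE bE] by simp
  obtain f where f: "is_inf X f" using ex_inf[OF XE dec] by blast
  have fb: "f \<in> bicommutant a" by (rule bic_inf[OF X dec f])
  then have fE: "f \<in> E" by (rule bic_E)
  have "is_inf (\<lambda>n. X (Suc n)) (P b f)"
    using inf_mult[OF XE dec f bE] by (simp add: XS)
  then have bf: "P b f = f" using is_inf_Suc[OF f dec] is_inf_unique by blast
  have Xf: "P (X n) f = f" for n
  proof (induction n)
    case 0 then show ?case by (simp add: X_def unit_left[OF fE])
  next
    case (Suc n)
    have "P (P b (X n)) f = P b (P (X n) f)" by (rule assoc[OF bE XE fE bic_commute[OF a b X], symmetric])
    then show ?case using Suc bf by (simp add: XS)
  qed
  \<comment> \<open>\<open>f\<close> absorbs every power, so normality in the second argument makes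
    it idempotent, and idempotents are sharp.\<close>
  have "P f (X n) = f" for n using bic_commute[OF a fb X] Xf by simp
  then have "P f f = f"
    using inf_mult[OF XE dec f fE] is_inf_const[of f] is_inf_unique by simp
  then have sf: "sharp f" using compl_right[OF fE fE] by (intro sharpI fE) simp
  have "f \<le> b" using is_inf_lower[OF f, of 1] by (simp add: X_def unit_right[OF bE])
  then have "\<alpha> \<le> u - f" by (simp add: b_def algebra_simps)
  \<comment> \<open>Since \<open>\<beta>\<close> annihilates \<open>\<alpha>\<close>, multiplying it
    by \<open>b\<close> or a power of \<open>b\<close> leaves it unchanged; so it lies below every
    power and below their infimum.\<close>
  moreover have "P \<beta> \<alpha> = 0" using zero_sym[OF alE beE 0] .
  then have beb: "P \<beta> b = \<beta>" unfolding b_def using compl_right[OF beE alE] by simp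
  have "P \<beta> (X n) = \<beta>" for n
  proof (induction n)
    case 0 then show ?case by (simp add: X_def unit_right[OF beE])
  next
    case (Suc n)
    then show ?case using assoc[OF beE bE XE bic_commute[OF a be b], of n] beb by (simp add: XS)
  qed
  then have "\<beta> \<le> X n" for n using bic_commute[OF a be X] le_left[OF XE beE] by metis
  then have "\<beta> \<le> f" by (rule is_inf_greatest[OF f])
  ultimately show ?thesis
    using fb sf by (intro that[of "u - f"] bic_compl sharp_compl) auto
qed

text \<open>
  The limits of the iteration \<open>(x, y) \<mapsto> (x - x y, y - x y)\<close> started at \<open>(a, u - a)\<close> are the
  positive and the negative part of \<open>2 a - u\<close>.
\<close>

lemma bic_parts:
  assumes a: "a \<in> E"
  obtains \<alpha> \<beta> where "\<alpha> \<in> bicommutant a" "\<beta> \<in> bicommutant a" "\<alpha> - \<beta> = a - (u - a)" "P \<alpha> \<beta> = 0"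
proof -
  define F where "F = (\<lambda>(x, y). (x - P x y, y - P x y))"
  define Z where "Z n = (F ^^ n) (a, u - a)" for n
  define X Y where "X n = fst (Z n)" and "Y n = snd (Z n)" for n
  have X0: "X 0 = a" "Y 0 = u - a" by (simp_all add: X_def Y_def Z_def)
  have XS: "X (Suc n) = X n - P (X n) (Y n)" "Y (Suc n) = Y n - P (X n) (Y n)" for n
    by (simp_all add: X_def Y_def Z_def F_def case_prod_beta)
  have bic: "X n \<in> bicommutant a \<and> Y n \<in> bicommutant a" for n
  proof (induction n)
    case 0 then show ?case by (simp add: X0 bic_self[OF a] bic_compl)
  next
    case (Suc n)
    then have E: "X n \<in> E" "Y n \<in> E" using bic_E by auto
    have "X n - P (X n) (Y n) = P (X n) (u - Y n)" using compl_right E by simp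
    moreover have "Y n - P (X n) (Y n) = P (Y n) (u - X n)"
      using compl_right E bic_commute[OF a, of "X n" "Y n"] Suc by simp
    ultimately show ?case using Suc by (simp add: XS bic_mult bic_compl)
  qed
  have Xb: "X n \<in> bicommutant a" and Yb: "Y n \<in> bicommutant a" for n using bic by auto
  have XE: "X n \<in> E" and YE: "Y n \<in> E" for n using Xb Yb bic_E by auto
  have PE: "0 \<le> P (X n) (Y n)" for n using XE YE by (rule nonneg)
  have dX: "decseq X" and dY: "decseq Y"
    unfolding decseq_Suc_iff using PE by (simp_all add: XS)
  have YX: "Y n = X n + (u - a - a)" for n
    by (induction n) (simp_all add: X0 XS algebra_simps)
  obtain \<alpha> where al: "is_inf X \<alpha>" using ex_inf[OF XE dX] by blast
  define \<beta> where "\<beta> = \<alpha> + (u - a - a)"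
  have be: "is_inf Y \<beta>" unfolding \<beta>_def using is_inf_shift[OF al, of "u - a - a"] by (simp flip: YX)
  have alb: "\<alpha> \<in> bicommutant a" and beb: "\<beta> \<in> bicommutant a"
    using bic_inf[OF Xb dX al] bic_inf[OF Yb dY be] by auto
  have alE: "\<alpha> \<in> E" and beE: "\<beta> \<in> E" using alb beb bic_E by auto
  have le: "P \<alpha> \<beta> \<le> P (X n) (Y n)" for n
  proof -
    have "P \<alpha> \<beta> \<le> P \<alpha> (Y n)" using is_inf_lower[OF be] by (intro mono_right alE beE YE)
    also have "\<dots> = P (Y n) \<alpha>" by (rule bic_commute[OF a alb Yb])
    also have "\<dots> \<le> P (Y n) (X n)" using is_inf_lower[OF al] by (intro mono_right alE XE YE)
    also have "\<dots> = P (X n) (Y n)" by (rule bic_commute[OF a Yb Xb])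
    finally show ?thesis .
  qed
  \<comment> \<open>Each iteration removes at least \<open>P \<alpha> \<beta>\<close> from
    \<open>X n\<close>, which never drops below 0. So all multiples of
    \<open>P \<alpha> \<beta>\<close> stay below \<open>u\<close>, which forces it to
    vanish.\<close>
  have sum: "real n *\<^sub>R P \<alpha> \<beta> \<le> a - X n" for n
  proof (induction n)
    case (Suc n)
    then show ?case using add_mono[OF Suc le[of n]] by (simp add: XS scaleR_left_distrib algebra_simps)
  qed (simp add: X0)
  have "real n *\<^sub>R P \<alpha> \<beta> \<le> u" for n
    using order_trans[OF sum[of n], of u] XE[of n] a diff_mono[of a u 0 "X n"] by simp
  then have "P \<alpha> \<beta> \<le> 0" by (rule archimedean_multiples)
  then have "P \<alpha> \<beta> = 0" using nonneg[OF alE beE] by simp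
  with alb beb show ?thesis by (intro that[of \<alpha> \<beta>]) (auto simp: \<beta>_def)
qed

text \<open>The digit \<open>p\<close> separates the positive part \<open>\<alpha>\<close> of
  \<open>2 a - u\<close> from the negative part \<open>\<beta>\<close>. Then
  \<open>2 a - p = \<alpha> + (u - p - \<beta>)\<close>, and \<open>\<alpha> \<le> p\<close> and
  \<open>\<beta> \<le> u - p\<close> put this remainder back into the interval.\<close>

lemma bic_digit:
  assumes a: "a \<in> E"
  shows "\<exists>p b. p \<in> bicommutant a \<and> b \<in> bicommutant a \<and> sharp p \<and> 2 *\<^sub>R a = p + b"
proof -
  obtain \<alpha> \<beta> where ab: "\<alpha> \<in> bicommutant a" "\<beta> \<in> bicommutant a" "\<alpha> - \<beta> = a - (u - a)" "P \<alpha> \<beta> = 0"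
    using bic_parts[OF a] .
  obtain p where p: "p \<in> bicommutant a" "sharp p" "\<alpha> \<le> p" "\<beta> \<le> u - p"
    using bic_support[OF a ab(1,2,4)] .
  have "p + \<beta> \<le> u" using p(4) by (simp add: algebra_simps)
  then have "u - (p + \<beta>) \<in> bicommutant a" using p ab by (intro bic_compl bic_add)
  moreover have "\<alpha> + (u - (p + \<beta>)) \<le> u"
    using p(3) bic_E[OF ab(2)] add_mono[of \<alpha> p 0 \<beta>] by (simp add: algebra_simps)
  ultimately have "\<alpha> + (u - (p + \<beta>)) \<in> bicommutant a" using ab by (intro bic_add)
  moreover have "2 *\<^sub>R a = p + (\<alpha> + (u - (p + \<beta>)))"
    using ab(3) by (simp add: scaleR_2 algebra_simps)
  ultimately show ?thesis using p by blast
qed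

text \<open>The digit of each remainder lies in the bicommutant of that remainder, hence by
  \<open>bic_trans\<close> in that of \<open>a\<close>. So all digits commute, and commuting is
  converted into the product-free \<open>splits\<close>.\<close>

theorem dyadic: assumes a: "a \<in> E" shows "dyadic a"
proof -
  define h where "h x = (SOME b. \<exists>p. p \<in> bicommutant x \<and> b \<in> bicommutant x \<and> sharp p \<and> 2 *\<^sub>R x = p + b)" for x
  have h: "\<exists>p. p \<in> bicommutant x \<and> h x \<in> bicommutant x \<and> sharp p \<and> 2 *\<^sub>R x = p + h x" if "x \<in> E" for x
    unfolding h_def by (rule someI_ex) (use bic_digit[OF that] in blast)
  define b where "b n = (h ^^ n) a" for n
  have b: "b n \<in> bicommutant a" for n
  proof (induction n)
    case 0 then show ?case by (simp add: b_def bic_self[OF a])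
  next
    case (Suc n)
    then have "h (b n) \<in> bicommutant (b n)" using h[of "b n"] bic_E by blast
    then show ?case using bic_trans[OF Suc] by (simp add: b_def)
  qed
  then have bE: "b n \<in> E" for n using bic_E by blast
  have "\<exists>p. p \<in> bicommutant a \<and> sharp p \<and> 2 *\<^sub>R b n = p + b (Suc n)" for n
  proof -
    have "b (Suc n) = h (b n)" by (simp add: b_def)
    then show ?thesis using h[OF bE[of n]] bic_trans[OF b[of n]] by metis
  qed
  then obtain p where p: "\<And>n. p n \<in> bicommutant a \<and> sharp (p n) \<and> 2 *\<^sub>R b n = p n + b (Suc n)"
    by metis
  have "splits (p m) (p n)" for m n
    using p[of m] p[of n] bic_E bic_commute[OF a] by (intro comm_splits) blast+
  moreover have "b 0 = a" by (simp add: b_def)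
  ultimately show ?thesis unfolding dyadic_def using p bE
    by (intro exI[of _ p] exI[of _ b]) simp
qed

end

section \<open>Linear extension and central scalars\<close>

context order_unit_space
begin

text \<open>\<open>D 0\<close> is \<open>(1/2) ^ n\<close> times the bounded \<open>D n\<close>.
  With \<open>D\<close> the difference of two quantities that obey the same binary recursion, this
  proves them equal.\<close>

lemma halving_sequence_zero:
  assumes "\<And>n. D n = (1/2) *\<^sub>R D (Suc n)" "\<And>n. - u \<le> D n" "\<And>n. D n \<le> u"
  shows "D 0 = 0"
proof (rule archimedean_eq_0)
  fix e :: real assume "e > 0"
  then obtain n where n: "(1/2::real) ^ n < e" using real_arch_pow_inv[of e "1/2"] by auto
  have D: "D 0 = (1/2)^n *\<^sub>R D n" for n
  proof (induction n)
    case (Suc n)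
    also have "(1/2)^n *\<^sub>R D n = (1/2)^n *\<^sub>R ((1/2) *\<^sub>R D (Suc n))" using assms(1)[of n] by (rule arg_cong)
    also have "\<dots> = (1/2)^Suc n *\<^sub>R D (Suc n)" by (simp add: mult.commute)
    finally show ?case .
  qed simp
  have "(1/2)^n *\<^sub>R D n \<le> (1/2)^n *\<^sub>R u" by (intro scaleR_left_mono assms) simp
  moreover have "(1/2)^n *\<^sub>R - u \<le> (1/2)^n *\<^sub>R D n" by (intro scaleR_left_mono assms) simp
  moreover have "(1/2)^n *\<^sub>R u \<le> e *\<^sub>R u" using n by (intro scaleR_u_mono) simp
  ultimately show "- (e *\<^sub>R u) \<le> D 0 \<and> D 0 \<le> e *\<^sub>R u"
    unfolding D[of n] scaleR_minus_right by (meson neg_le_iff_le order_trans)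
qed

text \<open>A single factor \<open>r\<close> for all three elements lets commutation pass between
  cone and interval, and \<open>a + b \<in> E\<close> covers the sum in
  \<open>comm_add\<close>.\<close>

lemma nonneg_common_scale:
  assumes "0 \<le> v" "0 \<le> w" "0 \<le> z"
  obtains r a b c where "r \<ge> 1" "a \<in> E" "b \<in> E" "c \<in> E" "a + b \<in> E"
    "v = r *\<^sub>R a" "w = r *\<^sub>R b" "z = r *\<^sub>R c"
proof -
  have "0 \<le> v + w + z" using assms by simp
  then obtain r x where r: "r \<ge> 1" "x \<in> E" "v + w + z = r *\<^sub>R x"
    by (rule nonneg_scale_unit_interval)
  have x: "x = inverse r *\<^sub>R (v + w + z)" using r by simp
  have in_E: "inverse r *\<^sub>R y \<in> E" if "0 \<le> y" "y \<le> v + w + z" for y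
  proof -
    have "inverse r *\<^sub>R y \<le> x" unfolding x using that r by (intro scaleR_left_mono) auto
    moreover have "0 \<le> inverse r *\<^sub>R y" using that r by (intro scaleR_nonneg_nonneg) auto
    ultimately show ?thesis using r(2) by (auto intro: order_trans)
  qed
  show ?thesis
  proof (rule that[OF r(1), of "inverse r *\<^sub>R v" "inverse r *\<^sub>R w" "inverse r *\<^sub>R z"])
    show "inverse r *\<^sub>R v + inverse r *\<^sub>R w \<in> E"
      unfolding scaleR_right_distrib[symmetric] using assms by (intro in_E) auto
    show "inverse r *\<^sub>R v \<in> E" "inverse r *\<^sub>R w \<in> E" "inverse r *\<^sub>R z \<in> E"
      using assms by (simp_all del: atLeastAtMost_iff add: in_E add.assoc add_increasing)
  qed (use r in auto)
qed

lemma linear_extension: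
  fixes g :: "'v \<Rightarrow> 'v"
  assumes add: "\<And>a b. a \<in> E \<Longrightarrow> b \<in> E \<Longrightarrow> a + b \<in> E \<Longrightarrow> g (a + b) = g a + g b"
    and scale: "\<And>a t. a \<in> E \<Longrightarrow> 0 \<le> t \<Longrightarrow> t \<le> 1 \<Longrightarrow> g (t *\<^sub>R a) = t *\<^sub>R g a"
  shows "\<exists>L. linear L \<and> (\<forall>a\<in>E. L a = g a)"
proof -
  define bd where "bd r w \<longleftrightarrow> 0 < r \<and> - (r *\<^sub>R u) \<le> w \<and> w \<le> r *\<^sub>R u" for r w
  \<comment> \<open>\<open>m r\<close> maps the interval between plus and minus
    \<open>r *\<^sub>R u\<close> affinely onto \<open>E\<close>, and \<open>h r\<close> undoes this
    map after \<open>g\<close> has been applied.\<close>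
  define m where "m r w = (1 / (2 * r)) *\<^sub>R (w + r *\<^sub>R u)" for r w
  define h where "h r w = (2 * r) *\<^sub>R g (m r w) - r *\<^sub>R g u" for r w
  have mE: "m r w \<in> E" if "bd r w" for r w
  proof -
    have "0 \<le> w + r *\<^sub>R u" "w + r *\<^sub>R u \<le> (2 * r) *\<^sub>R u"
      using that add_mono[of "- (r *\<^sub>R u)" w "r *\<^sub>R u" "r *\<^sub>R u"] add_mono[of w "r *\<^sub>R u" "r *\<^sub>R u" "r *\<^sub>R u"]
      unfolding bd_def mult_2 scaleR_left_distrib by simp_all
    then have "0 \<le> m r w" "m r w \<le> (1 / (2 * r)) *\<^sub>R ((2 * r) *\<^sub>R u)"
      using that unfolding m_def bd_def
      by (auto intro!: scaleR_nonneg_nonneg scaleR_left_mono simp del: scaleR_scaleR)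
    then show ?thesis using that by (simp add: bd_def)
  qed
  have gadd: "g (s *\<^sub>R a + t *\<^sub>R b) = s *\<^sub>R g a + t *\<^sub>R g b"
    if "a \<in> E" "b \<in> E" "0 \<le> s" "0 \<le> t" "s + t \<le> 1" for a b s t
  proof -
    have E: "s *\<^sub>R a \<in> E" "t *\<^sub>R b \<in> E" using that by (auto intro!: scale_in_E simp del: atLeastAtMost_iff)
    have "s *\<^sub>R a + t *\<^sub>R b \<le> s *\<^sub>R u + t *\<^sub>R u"
      using that by (intro add_mono scaleR_left_mono) auto
    also have "\<dots> \<le> 1 *\<^sub>R u" unfolding scaleR_left_distrib[symmetric] by (rule scaleR_u_mono[OF that(5)])
    finally have "s *\<^sub>R a + t *\<^sub>R b \<in> E" using E by simp
    then show ?thesis using add[OF E] scale that by simp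
  qed
  \<comment> \<open>Enlarging the bound replaces \<open>m r w\<close> by a combination of
    \<open>m r w\<close> and \<open>u\<close> with nonnegative weights of total at most 1, so
    \<open>gadd\<close> applies.\<close>
  have indep: "h r w = h s w" if b: "bd r w" "bd s w" "r \<le> s" for r s w
  proof -
    have rs: "0 < r" "0 < s" using b bd_def by auto
    have "m s w = (1 / (2 * s)) *\<^sub>R w + (1 / 2) *\<^sub>R u"
      "(r / s) *\<^sub>R m r w = (1 / (2 * s)) *\<^sub>R w + (r / (2 * s)) *\<^sub>R u"
      using rs by (simp_all add: m_def scaleR_right_distrib mult.commute)
    moreover have "r / (2 * s) + (s - r) / (2 * s) = 1 / 2" using rs by (simp add: field_simps)
    then have "(1 / 2) *\<^sub>R u = (r / (2 * s)) *\<^sub>R u + ((s - r) / (2 * s)) *\<^sub>R u"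
      by (metis scaleR_left_distrib)
    ultimately have "m s w = (r / s) *\<^sub>R m r w + ((s - r) / (2 * s)) *\<^sub>R u"
      by (simp only: add.assoc)
    moreover have "g ((r / s) *\<^sub>R m r w + ((s - r) / (2 * s)) *\<^sub>R u) = (r / s) *\<^sub>R g (m r w) + ((s - r) / (2 * s)) *\<^sub>R g u"
      using rs b(3) by (intro gadd[OF mE[OF b(1)] u_in_E]) (auto simp: field_simps)
    moreover have "2 * s * (r / s) = 2 * r" "2 * s * ((s - r) / (2 * s)) = s - r"
      using rs by simp_all
    ultimately show ?thesis
      unfolding h_def by (simp only: scaleR_right_distrib scaleR_scaleR scaleR_left_diff_distrib) simp
  qed
  define L where "L w = h (SOME r. bd r w) w" for w
  have L: "L w = h r w" if "bd r w" for r w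
  proof -
    have "bd (SOME r. bd r w) w" by (rule someI[of "\<lambda>r. bd r w", OF that])
    then show ?thesis unfolding L_def using indep that by (metis linorder_linear)
  qed
  have ex: "\<exists>r. bd r w" for w using order_unit_real unfolding bd_def by blast
  have bd_mono: "bd s w" if "bd r w" "r \<le> s" for r s w
    using that scaleR_u_mono[OF that(2)] unfolding bd_def by (meson neg_le_iff_le order_trans less_le_trans)
  have Ladd: "L (x + y) = L x + L y" for x y
  proof -
    obtain r1 r2 where "bd r1 x" "bd r2 y" using ex by metis
    then have r: "bd (max r1 r2) x" "bd (max r1 r2) y" by (auto intro: bd_mono)
    define r where "r = max r1 r2"
    have b: "bd r x" "bd r y" using r r_def by auto
    have r0: "0 < r" using b bd_def by auto
    have "- (r *\<^sub>R u) + - (r *\<^sub>R u) \<le> x + y" "x + y \<le> r *\<^sub>R u + r *\<^sub>R u"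
      using b add_mono[of "- (r *\<^sub>R u)" x "- (r *\<^sub>R u)" y] add_mono[of x "r *\<^sub>R u" y "r *\<^sub>R u"]
      unfolding bd_def by blast+
    then have b2: "bd (2 * r) (x + y)"
      unfolding bd_def mult_2 scaleR_left_distrib minus_add_distrib using r0 by auto
    have "m (2 * r) (x + y) = (1/2) *\<^sub>R m r x + (1/2) *\<^sub>R m r y"
      using r0 by (simp add: m_def scaleR_right_distrib) (simp flip: scaleR_left_distrib)
    then have "g (m (2 * r) (x + y)) = (1/2) *\<^sub>R g (m r x) + (1/2) *\<^sub>R g (m r y)"
      using mE b by (simp del: atLeastAtMost_iff add: gadd)
    moreover have "(2 * r) *\<^sub>R g u = r *\<^sub>R g u + r *\<^sub>R g u" by (simp flip: scaleR_left_distrib)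
    ultimately have "h (2 * r) (x + y) = h r x + h r y"
      by (simp add: h_def scaleR_right_distrib)
    then show ?thesis using L[OF b2] L[OF b(1)] L[OF b(2)] by simp
  qed
  have Lpos: "L (c *\<^sub>R x) = c *\<^sub>R L x" if c: "0 < c" for c x
  proof -
    obtain r where b: "bd r x" using ex by blast
    have r0: "0 < r" using b bd_def by auto
    have "c *\<^sub>R - (r *\<^sub>R u) \<le> c *\<^sub>R x" "c *\<^sub>R x \<le> c *\<^sub>R (r *\<^sub>R u)"
      using b c unfolding bd_def by (auto intro!: scaleR_left_mono simp del: scaleR_scaleR scaleR_minus_right)
    then have b2: "bd (c * r) (c *\<^sub>R x)" using c r0 by (simp add: bd_def)
    have "m (c * r) (c *\<^sub>R x) = m r x"
      using c r0 by (simp add: m_def scaleR_right_distrib)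
    then show ?thesis using L[OF b2] L[OF b] by (simp add: h_def scaleR_right_diff_distrib mult.left_commute)
  qed
  have L0: "L 0 = 0" using Ladd[of 0 0] by simp
  have Lneg: "L (- x) = - L x" for x using Ladd[of x "- x"] L0 by (simp add: minus_unique)
  have "L (c *\<^sub>R x) = c *\<^sub>R L x" for c x
  proof -
    consider "c > 0" | "c = 0" | "c < 0" by linarith
    then show ?thesis
    proof cases
      case 3 then show ?thesis using Lpos[of "- c" x] Lneg[of "c *\<^sub>R x"] by simp
    qed (simp_all add: Lpos L0)
  qed
  then have "linear L" using Ladd by (intro linearI) auto
  moreover have "L a = g a" if a: "a \<in> E" for a
  proof -
    have "bd 1 a" using a unfolding bd_def by (auto intro: order_trans[of _ 0])
    moreover have "m 1 a = (1/2) *\<^sub>R a + (1/2) *\<^sub>R u" by (simp add: m_def scaleR_right_distrib)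
    then have "h 1 a = g a" using a by (simp del: atLeastAtMost_iff add: h_def gadd scaleR_right_distrib)
    ultimately show ?thesis using L by simp
  qed
  ultimately show ?thesis by blast
qed

lemma conv_scale: "0 \<le> c \<Longrightarrow> conv X x \<Longrightarrow> conv (\<lambda>n. c *\<^sub>R X n) (c *\<^sub>R x)"
  by (rule conv_positive_linear) (auto intro: scaleR_nonneg_nonneg linearI simp: scaleR_right_distrib)

lemma conv_offset: "conv (\<lambda>n. X (n + N)) x \<longleftrightarrow> conv X x"
proof
  assume l: "conv (\<lambda>n. X (n + N)) x"
  show "conv X x" unfolding conv_def
  proof (intro allI impI)
    fix e :: real assume "e > 0"
    from convD[OF l this] obtain M where
      M: "\<And>n. n \<ge> M \<Longrightarrow> - (e *\<^sub>R u) \<le> X (n + N) - x \<and> X (n + N) - x \<le> e *\<^sub>R u" by auto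
    show "\<exists>N. \<forall>n\<ge>N. - (e *\<^sub>R u) \<le> X n - x \<and> X n - x \<le> e *\<^sub>R u"
      using M by (intro exI[of _ "M + N"]) (metis add_leD2 le_add_diff_inverse2 le_diff_conv2)
  qed
qed (unfold conv_def, meson trans_le_add1)

end

text \<open>The property \<open>dyadic\<close> mentions no product, so the normal product can supply
  it to any other product on the same interval.\<close>

locale dyadic_product = ou_product u P
  for u :: "'v::ordered_real_vector" and P :: "'v \<Rightarrow> 'v \<Rightarrow> 'v" +
  assumes dyadic: "a \<in> E \<Longrightarrow> dyadic a"
begin

text \<open>A scalar multiple of \<open>u\<close> splits along every sharp \<open>p\<close> into
  multiples of \<open>p\<close> and \<open>u - p\<close>, so the value at \<open>p\<close> is
  forced. For general \<open>a\<close> both sides obey the recursion given by the digits of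
  \<open>a\<close>.\<close>

lemma scalar_left:
  assumes t: "0 \<le> t" "t \<le> 1" and a: "a \<in> E"
  shows "P (t *\<^sub>R u) a = t *\<^sub>R a"
proof -
  have tE: "t *\<^sub>R u \<in> E" using t by (intro scale_in_E) auto
  have sharp: "P (t *\<^sub>R u) p = t *\<^sub>R p" if p: "sharp p" for p
  proof -
    have pE: "p \<in> E" using p sharp_def by blast
    then have E: "t *\<^sub>R p \<in> E" "t *\<^sub>R (u - p) \<in> E" using t by (auto intro!: scale_in_E simp del: atLeastAtMost_iff simp: compl_in_E)
    have le: "t *\<^sub>R p \<le> 1 *\<^sub>R p" "t *\<^sub>R (u - p) \<le> 1 *\<^sub>R (u - p)"
      using pE t by (auto intro!: scaleR_right_mono simp del: scaleR_one)
    have eq: "t *\<^sub>R u = t *\<^sub>R p + t *\<^sub>R (u - p)" by (simp flip: scaleR_right_distrib)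
    have "splits p (t *\<^sub>R u)" unfolding splits_def eq using E le
      by (intro exI[of _ "t *\<^sub>R p"] exI[of _ "t *\<^sub>R (u - p)"]) auto
    then have "P p (t *\<^sub>R u) = P (t *\<^sub>R u) p" using splits_comm[OF p] tE by blast
    moreover have "P p (t *\<^sub>R p + t *\<^sub>R (u - p)) = t *\<^sub>R p" using splits_value[OF p] E le by auto
    ultimately show ?thesis using eq by simp
  qed
  obtain p b where b: "b 0 = a" "\<And>n. b n \<in> E" "\<And>n. sharp (p n)" "\<And>n. 2 *\<^sub>R b n = p n + b (Suc n)"
    using dyadic[OF a] unfolding dyadic_def by blast
  have pE: "p n \<in> E" for n using b(3) sharp_def by blast
  define D where "D n = P (t *\<^sub>R u) (b n) - t *\<^sub>R b n" for n
  have "D 0 = 0"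
  proof (rule halving_sequence_zero)
    fix n
    have "(1/2) *\<^sub>R (2 *\<^sub>R b n) = (1/2) *\<^sub>R p n + (1/2) *\<^sub>R b (Suc n)" unfolding b(4) by (rule scaleR_right_distrib)
    then have bn: "b n = (1/2) *\<^sub>R p n + (1/2) *\<^sub>R b (Suc n)" by simp
    have E: "(1/2) *\<^sub>R p n \<in> E" "(1/2) *\<^sub>R b (Suc n) \<in> E" using pE b(2) by (auto intro!: scale_in_E simp del: atLeastAtMost_iff)
    have "P (t *\<^sub>R u) (b n) = P (t *\<^sub>R u) ((1/2) *\<^sub>R p n) + P (t *\<^sub>R u) ((1/2) *\<^sub>R b (Suc n))"
      using add_right[OF tE E] b(2)[of n] bn by simp
    also have "\<dots> = (1/2) *\<^sub>R (t *\<^sub>R p n) + (1/2) *\<^sub>R P (t *\<^sub>R u) (b (Suc n))"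
      using scale_right[OF tE pE, of "1/2"] scale_right[OF tE b(2), of "1/2"] sharp[OF b(3)] by simp
    finally show "D n = (1/2) *\<^sub>R D (Suc n)"
      unfolding D_def by (subst (2) bn) (simp add: algebra_simps)
    have 1: "P (t *\<^sub>R u) (b n) \<in> E" "t *\<^sub>R b n \<in> E" using closed[OF tE b(2)] scale_in_E[OF t b(2)] by auto
    then show "D n \<le> u" unfolding D_def using diff_mono[of "P (t *\<^sub>R u) (b n)" u 0 "t *\<^sub>R b n"] by simp
    show "- u \<le> D n" unfolding D_def using 1 diff_mono[of 0 "P (t *\<^sub>R u) (b n)" "t *\<^sub>R b n" u] by simp
  qed
  then show ?thesis by (simp add: D_def b)
qed

text \<open>Scalars commute with \<open>a\<close>, so associativity moves \<open>t\<close> into the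
  first factor.\<close>

lemma scale_left:
  assumes t: "0 \<le> t" "t \<le> 1" and E: "a \<in> E" "b \<in> E"
  shows "P (t *\<^sub>R a) b = t *\<^sub>R P a b"
proof -
  have tE: "t *\<^sub>R u \<in> E" using t by (intro scale_in_E) auto
  have "P (t *\<^sub>R u) a = P a (t *\<^sub>R u)"
    using scalar_left[OF t E(1)] scale_right[OF E(1) u_in_E t] unit_right[OF E(1)] by simp
  then have "P (t *\<^sub>R u) (P a b) = P (P (t *\<^sub>R u) a) b" by (rule assoc[OF tE E])
  then show ?thesis using scalar_left[OF t E(1)] scalar_left[OF t closed[OF E]] by simp
qed

end

locale continuous_product = dyadic_product u P
  for u :: "'v::ordered_real_vector" and P :: "'v \<Rightarrow> 'v \<Rightarrow> 'v" +
  assumes continuous: "(\<And>n. X n \<in> E) \<Longrightarrow> a \<in> E \<Longrightarrow> b \<in> E \<Longrightarrow> conv X a \<Longrightarrow> conv (\<lambda>n. P (X n) b) (P a b)"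
begin

text \<open>Continuity concerns the first argument only. Replacing the second \<open>X n\<close> by
  the fixed \<open>a\<close> costs \<open>r n *\<^sub>R P (X n) (Y n)\<close>, which lies between 0
  and \<open>r n *\<^sub>R u\<close>.\<close>

lemma square_conv:
  assumes X: "\<And>n. X n \<in> E" and a: "a \<in> E" and conv: "conv X a"
    and r: "r \<longlonglongrightarrow> 0" "\<And>n. 0 \<le> r n \<and> r n \<le> (1::real)" and Y: "\<And>n. Y n \<in> E" "\<And>n. a = X n + r n *\<^sub>R Y n"
  shows "conv (\<lambda>n. P (X n) (X n)) (P a a)"
proof -
  have "conv (\<lambda>n. P (X n) a - r n *\<^sub>R P (X n) (Y n)) (P a a - 0)"
  proof (intro conv_diff continuous X a conv conv_real_bound[OF r(1)])
    fix n
    have "0 \<le> r n *\<^sub>R P (X n) (Y n)" using r(2)[of n] nonneg[OF X Y(1)] by (simp add: scaleR_nonneg_nonneg)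
    moreover have "- (r n *\<^sub>R u) \<le> 0" using r(2)[of n] by (simp add: scaleR_nonneg_nonneg)
    ultimately show "- (r n *\<^sub>R u) \<le> r n *\<^sub>R P (X n) (Y n) - 0" by (metis diff_zero order_trans)
    have "r n *\<^sub>R P (X n) (Y n) \<le> r n *\<^sub>R u"
      using r(2)[of n] closed[OF X[of n] Y(1)[of n]] by (intro scaleR_left_mono) auto
    then show "r n *\<^sub>R P (X n) (Y n) - 0 \<le> r n *\<^sub>R u" by simp
  qed
  moreover have "P (X n) (X n) = P (X n) a - r n *\<^sub>R P (X n) (Y n)" for n
    using add_right[OF X X scale_in_E[OF _ _ Y(1)], of "r n" n n] r(2)[of n] Y(2)[of n] a
      scale_right[OF X Y(1), of "r n"] by simp
  ultimately show ?thesis by simp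
qed

end

section \<open>Uniqueness for products on the cone\<close>

text \<open>An effect other than \<open>u\<close> has its inverse, if any, outside the unit
  interval, so the argument about inverses is carried out on the whole cone.\<close>

locale cone_product = order_unit_space u for u :: "'v::ordered_real_vector" +
  fixes S :: "'v \<Rightarrow> 'v \<Rightarrow> 'v"
  assumes linear: "0 \<le> v \<Longrightarrow> linear (S v)"
    and nonneg: "0 \<le> v \<Longrightarrow> 0 \<le> w \<Longrightarrow> 0 \<le> S v w"
    and unit_left: "S u w = w"
    and unit_right: "0 \<le> v \<Longrightarrow> S v u = v"
    and scale_left: "0 \<le> v \<Longrightarrow> 0 \<le> r \<Longrightarrow> S (r *\<^sub>R v) w = r *\<^sub>R S v w"
    and assoc: "0 \<le> v \<Longrightarrow> 0 \<le> w \<Longrightarrow> S v w = S w v \<Longrightarrow> S v (S w x) = S (S v w) x"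
    and comm_mult: "0 \<le> v \<Longrightarrow> 0 \<le> w \<Longrightarrow> 0 \<le> z \<Longrightarrow> S z v = S v z \<Longrightarrow> S z w = S w z \<Longrightarrow>
          S z (S v w) = S (S v w) z"
    and comm_add: "0 \<le> v \<Longrightarrow> 0 \<le> w \<Longrightarrow> 0 \<le> z \<Longrightarrow> S z v = S v z \<Longrightarrow> S z w = S w z \<Longrightarrow>
          S z (v + w) = S (v + w) z"
    and comm_diff: "0 \<le> w \<Longrightarrow> w \<le> v \<Longrightarrow> 0 \<le> z \<Longrightarrow> S z v = S v z \<Longrightarrow> S z w = S w z \<Longrightarrow>
          S z (v - w) = S (v - w) z"
    and conv_left: "(\<And>n. 0 \<le> X n) \<Longrightarrow> 0 \<le> x \<Longrightarrow> conv X x \<Longrightarrow> 0 \<le> z \<Longrightarrow> conv (\<lambda>n. S (X n) z) (S x z)"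
begin

lemma add_right: "0 \<le> v \<Longrightarrow> S v (x + y) = S v x + S v y"
  by (rule linear_add[OF linear])

lemma diff_right: "0 \<le> v \<Longrightarrow> S v (x - y) = S v x - S v y"
  by (rule linear_diff[OF linear])

lemma scale_right: "0 \<le> v \<Longrightarrow> S v (r *\<^sub>R x) = r *\<^sub>R S v x"
  by (rule linear_scale[OF linear])

lemma mono_right: "0 \<le> v \<Longrightarrow> x \<le> y \<Longrightarrow> S v x \<le> S v y"
  using nonneg[of v "y - x"] by (simp add: diff_right)

lemma conv_right: "0 \<le> v \<Longrightarrow> conv X x \<Longrightarrow> conv (\<lambda>n. S v (X n)) (S v x)"
  by (rule conv_positive_linear[OF linear]) (auto intro: nonneg)

text \<open>\<open>X n \<le> u\<close> makes the maps \<open>S (X n)\<close> uniformly bounded, so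
  they carry the null sequence \<open>Y n - y\<close> to a null sequence; continuity in the first
  factor does the rest.\<close>

lemma conv_mult:
  assumes "\<And>n. 0 \<le> X n" "\<And>n. X n \<le> u" "0 \<le> x" "0 \<le> y" "conv X x" "conv Y y"
  shows "conv (\<lambda>n. S (X n) (Y n)) (S x y)"
proof -
  have "conv (\<lambda>n. S (X n) (Y n - y)) 0"
    unfolding conv_def
  proof (intro allI impI)
    fix e :: real assume e: "e > 0"
    from convD[OF assms(6) this] obtain N where
      N: "\<And>n. n \<ge> N \<Longrightarrow> - (e *\<^sub>R u) \<le> Y n - y \<and> Y n - y \<le> e *\<^sub>R u" by auto
    show "\<exists>N. \<forall>n\<ge>N. - (e *\<^sub>R u) \<le> S (X n) (Y n - y) - 0 \<and> S (X n) (Y n - y) - 0 \<le> e *\<^sub>R u"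
    proof (intro exI[of _ N] allI impI)
      fix n assume n: "n \<ge> N"
      have le: "e *\<^sub>R X n \<le> e *\<^sub>R u" using e assms(2) by (intro scaleR_left_mono) auto
      have "S (X n) (Y n - y) \<le> S (X n) (e *\<^sub>R u)"
        using N[OF n] by (intro mono_right assms(1)) auto
      then have 1: "S (X n) (Y n - y) \<le> e *\<^sub>R X n" by (simp add: scale_right unit_right assms(1))
      have "S (X n) ((- e) *\<^sub>R u) \<le> S (X n) (Y n - y)"
        using N[OF n] by (intro mono_right assms(1)) auto
      then have "- (e *\<^sub>R X n) \<le> S (X n) (Y n - y)"
        unfolding scale_right[OF assms(1)] unit_right[OF assms(1)] by simp
      with le 1 show "- (e *\<^sub>R u) \<le> S (X n) (Y n - y) - 0 \<and> S (X n) (Y n - y) - 0 \<le> e *\<^sub>R u"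
        unfolding diff_0_right by (meson neg_le_iff_le order_trans)
    qed
  qed
  from conv_add[OF this conv_left[OF assms(1,3,5,4)]] show ?thesis
    by (simp add: diff_right[OF assms(1)])
qed

definition is_inverse :: "'v \<Rightarrow> 'v \<Rightarrow> bool" where
  "is_inverse b c \<longleftrightarrow> 0 \<le> c \<and> S b c = u \<and> S c b = u"

lemma is_inverse_unique:
  assumes "0 \<le> b" "is_inverse b c" "is_inverse b d" shows "c = d"
proof -
  have "S c (S b d) = S (S c b) d" using assms by (intro assoc) (auto simp: is_inverse_def)
  then show ?thesis using assms unit_right[of c] unit_left[of d] by (simp add: is_inverse_def)
qed

lemma is_inverse_cancel:
  assumes "0 \<le> b" "is_inverse b c" shows "S b (S c w) = w" "S c (S b w) = w"
  using assoc[of b c w] assoc[of c b w] assms by (auto simp: is_inverse_def unit_left)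

end

text \<open>\<open>geometric_conv\<close> is the form of completeness that the iterations rely on:
  increasing sequences whose increments decay geometrically converge. It is later derived from
  infima.\<close>

locale cone_product_pair = S: cone_product u S + T: cone_product u T
  for u :: "'v::ordered_real_vector" and S T :: "'v \<Rightarrow> 'v \<Rightarrow> 'v" +
  assumes squares: "0 \<le> a \<Longrightarrow> S a a = T a a"
    and geometric_conv: "\<lbrakk>0 \<le> q; q < 1; \<And>n. X n \<le> X (Suc n); \<And>n. X (Suc n) - X n \<le> q ^ n *\<^sub>R u\<rbrakk> \<Longrightarrow>
          \<exists>x. S.conv X x"
begin

abbreviation (input) "conv \<equiv> S.conv"

text \<open>The two commutation relations are kept apart because \<open>S z a = S a z\<close> is not
  known to be equivalent to \<open>T z a = T a z\<close>. Members commute with each other under both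
  products (\<open>D_comm\<close>).\<close>

definition joint_bicommutant :: "'v \<Rightarrow> 'v set" where
  "joint_bicommutant a = {x. 0 \<le> x \<and> (\<forall>z\<ge>0. (S z a = S a z \<longrightarrow> S z x = S x z) \<and>
     (T z a = T a z \<longrightarrow> T z x = T x z))}"

section \<open>Inverses and square roots inside the joint bicommutant of \<open>a\<close>\<close>

context
  fixes a :: 'v assumes a: "0 \<le> a"
begin

abbreviation "D \<equiv> joint_bicommutant a"

lemma D_nonneg: "x \<in> D \<Longrightarrow> 0 \<le> x"
  and D_S: "x \<in> D \<Longrightarrow> 0 \<le> z \<Longrightarrow> S z a = S a z \<Longrightarrow> S z x = S x z"
  and D_T: "x \<in> D \<Longrightarrow> 0 \<le> z \<Longrightarrow> T z a = T a z \<Longrightarrow> T z x = T x z"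
  by (simp_all add: joint_bicommutant_def)

lemma D_I: "0 \<le> x \<Longrightarrow> (\<And>z. 0 \<le> z \<Longrightarrow> S z a = S a z \<Longrightarrow> S z x = S x z) \<Longrightarrow>
    (\<And>z. 0 \<le> z \<Longrightarrow> T z a = T a z \<Longrightarrow> T z x = T x z) \<Longrightarrow> x \<in> D"
  by (simp add: joint_bicommutant_def)

lemma D_self: "a \<in> D" using a by (intro D_I)

lemma D_unit: "u \<in> D"
  by (intro D_I) (simp_all add: S.unit_left S.unit_right T.unit_left T.unit_right)

lemma D_add: assumes "x \<in> D" "y \<in> D" shows "x + y \<in> D"
proof (rule D_I)
  note nn = assms[THEN D_nonneg]
  show "0 \<le> x + y" using nn by simp
  show "S z (x + y) = S (x + y) z" if z: "0 \<le> z" "S z a = S a z" for z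
    by (rule S.comm_add[OF nn z(1) D_S[OF assms(1) z] D_S[OF assms(2) z]])
  show "T z (x + y) = T (x + y) z" if z: "0 \<le> z" "T z a = T a z" for z
    by (rule T.comm_add[OF nn z(1) D_T[OF assms(1) z] D_T[OF assms(2) z]])
qed

lemma D_diff: assumes "x \<in> D" "y \<in> D" and le: "y \<le> x" shows "x - y \<in> D"
proof (rule D_I)
  note nn = D_nonneg[OF assms(2)] le
  show "0 \<le> x - y" using le by simp
  show "S z (x - y) = S (x - y) z" if z: "0 \<le> z" "S z a = S a z" for z
    by (rule S.comm_diff[OF nn z(1) D_S[OF assms(1) z] D_S[OF assms(2) z]])
  show "T z (x - y) = T (x - y) z" if z: "0 \<le> z" "T z a = T a z" for z
    by (rule T.comm_diff[OF nn z(1) D_T[OF assms(1) z] D_T[OF assms(2) z]])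
qed

lemma D_scale: assumes x: "x \<in> D" and r: "0 \<le> r" shows "r *\<^sub>R x \<in> D"
proof (rule D_I)
  note x0 = D_nonneg[OF x]
  show "0 \<le> r *\<^sub>R x" using x0 r by (simp add: scaleR_nonneg_nonneg)
  show "S z (r *\<^sub>R x) = S (r *\<^sub>R x) z" if z: "0 \<le> z" "S z a = S a z" for z
    unfolding S.scale_right[OF z(1)] S.scale_left[OF x0 r] D_S[OF x z] ..
  show "T z (r *\<^sub>R x) = T (r *\<^sub>R x) z" if z: "0 \<le> z" "T z a = T a z" for z
    unfolding T.scale_right[OF z(1)] T.scale_left[OF x0 r] D_T[OF x z] ..
qed

lemma D_conv: assumes "\<And>n. X n \<in> D" "conv X x" shows "x \<in> D"
proof -
  have X: "0 \<le> X n" for n using assms(1) D_nonneg by blast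
  have x: "0 \<le> x" by (rule S.conv_nonneg[OF assms(2) X])
  show ?thesis
  proof (rule D_I[OF x])
    fix z assume z: "0 \<le> z" "S z a = S a z"
    show "S z x = S x z"
      using S.conv_right[OF z(1) assms(2)] S.conv_left[OF X x assms(2) z(1)]
      unfolding D_S[OF assms(1) z] by (rule S.conv_unique)
  next
    fix z assume z: "0 \<le> z" "T z a = T a z"
    show "T z x = T x z"
      using T.conv_right[OF z(1) assms(2)] T.conv_left[OF X x assms(2) z(1)]
      unfolding D_T[OF assms(1) z] by (rule S.conv_unique)
  qed
qed

lemma D_comm: assumes "x \<in> D" "y \<in> D" shows "S x y = S y x" "T x y = T y x"
proof -
  note nn = D_nonneg[OF assms(1)]
  have "S x a = S a x" using D_S[OF assms(1) a] by simp
  then show "S x y = S y x" by (rule D_S[OF assms(2) nn])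
  have "T x a = T a x" using D_T[OF assms(1) a] by simp
  then show "T x y = T y x" by (rule D_T[OF assms(2) nn])
qed

text \<open>Polarization of \<open>squares\<close>.\<close>

lemma D_agree: assumes "x \<in> D" "y \<in> D" shows "S x y = T x y"
proof -
  note nn = assms[THEN D_nonneg]
  have xy: "x + y \<in> D" by (rule D_add[OF assms])
  note nn' = D_nonneg[OF xy]
  have "S (x + y) (x + y) = S (x + y) x + S (x + y) y" by (rule S.add_right[OF nn'])
  also have "\<dots> = S x (x + y) + S y (x + y)" by (simp only: D_comm[OF xy assms(1)] D_comm[OF xy assms(2)])
  also have "\<dots> = S x x + S y y + 2 *\<^sub>R S x y"
    using D_comm[OF assms] nn by (simp add: S.add_right scaleR_2)
  finally have 1: "S (x + y) (x + y) = S x x + S y y + 2 *\<^sub>R S x y" .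
  have "T (x + y) (x + y) = T (x + y) x + T (x + y) y" by (rule T.add_right[OF nn'])
  also have "\<dots> = T x (x + y) + T y (x + y)" by (simp only: D_comm[OF xy assms(1)] D_comm[OF xy assms(2)])
  also have "\<dots> = T x x + T y y + 2 *\<^sub>R T x y"
    using D_comm[OF assms] nn by (simp add: T.add_right scaleR_2)
  finally have 2: "T (x + y) (x + y) = T x x + T y y + 2 *\<^sub>R T x y" .
  from 1 2 show ?thesis using squares[OF nn'] squares[OF nn(1)] squares[OF nn(2)] by simp
qed

text \<open>The \<open>T\<close> half needs \<open>D_agree\<close>: on members \<open>S x y\<close>
  equals \<open>T x y\<close>, and for the latter \<open>T.comm_mult\<close> applies.\<close>

lemma D_mult: assumes "x \<in> D" "y \<in> D" shows "S x y \<in> D"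
proof (rule D_I)
  note nn = assms[THEN D_nonneg]
  show "0 \<le> S x y" using nn by (rule S.nonneg)
  show "S z (S x y) = S (S x y) z" if z: "0 \<le> z" "S z a = S a z" for z
    by (rule S.comm_mult[OF nn z(1) D_S[OF assms(1) z] D_S[OF assms(2) z]])
  show "T z (S x y) = T (S x y) z" if z: "0 \<le> z" "T z a = T a z" for z
    unfolding D_agree[OF assms]
    by (rule T.comm_mult[OF nn z(1) D_T[OF assms(1) z] D_T[OF assms(2) z]])
qed

text \<open>The Neumann series of \<open>d = u - a\<close>: the increments of \<open>X\<close> are
  the powers of \<open>d\<close>, bounded by \<open>q ^ n *\<^sub>R u\<close>, and the limit
  satisfies \<open>x = u + S d x\<close>.\<close>

lemma D_inverse:
  assumes q: "0 \<le> q" "q < 1" and "u - a \<le> q *\<^sub>R u" and "a \<le> u"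
  shows "\<exists>c\<in>D. S a c = u"
proof -
  define d where "d = u - a"
  have d: "d \<in> D" "d \<le> q *\<^sub>R u" unfolding d_def using D_diff[OF D_unit D_self] assms by auto
  note d0 = D_nonneg[OF d(1)]
  define X where "X n = ((\<lambda>x. u + S d x) ^^ n) 0" for n
  have X0: "X 0 = 0" and XS: "X (Suc n) = u + S d (X n)" for n by (simp_all add: X_def)
  have zero: "0 \<in> D" using D_scale[OF D_unit, of 0] by simp
  have XD: "X n \<in> D" for n by (induction n) (simp_all add: X0 XS zero D_add D_unit D_mult d)
  have inc: "0 \<le> X (Suc n) - X n \<and> X (Suc n) - X n \<le> q ^ n *\<^sub>R u" for n
  proof (induction n)
    case 0 then show ?case by (simp add: X0 XS linear_0[OF S.linear[OF d0]])
  next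
    case (Suc n)
    have eq: "X (Suc (Suc n)) - X (Suc n) = S d (X (Suc n) - X n)"
      by (simp add: S.diff_right[OF d0] XS[of "Suc n"]) (simp add: XS)
    have "S d (X (Suc n) - X n) \<le> S d (q ^ n *\<^sub>R u)" using Suc by (intro S.mono_right d0) simp
    also have "\<dots> = q ^ n *\<^sub>R d" by (simp add: S.scale_right S.unit_right d0)
    also have "\<dots> \<le> q ^ n *\<^sub>R (q *\<^sub>R u)" using q d by (intro scaleR_left_mono) auto
    finally show ?case using Suc S.nonneg[OF d0] unfolding eq by (simp add: mult.commute)
  qed
  obtain x where x: "conv X x" using geometric_conv[OF q, of X] inc by auto
  have xD: "x \<in> D" by (rule D_conv[OF XD x])
  have "conv (\<lambda>n. X (Suc n)) (u + S d x)"
    unfolding XS by (intro S.conv_add S.conv_const S.conv_right d0 x)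
  then have xeq: "x = u + S d x" using S.conv_Suc[OF x] S.conv_unique by blast
  have "S a x = S x a" by (rule D_comm[OF D_self xD])
  also have "\<dots> = S x u - S x d" using S.diff_right[OF D_nonneg[OF xD], of u d] by (simp add: d_def)
  also have "\<dots> = x - S d x" using D_comm(1)[OF d(1) xD] by (simp add: S.unit_right D_nonneg[OF xD])
  also have "\<dots> = u" by (subst xeq) simp
  finally show ?thesis using xD by blast
qed

text \<open>A fixed point of \<open>y \<mapsto> (d + y\<^sup>2) / 2\<close> with
  \<open>d = u - a\<close> satisfies \<open>(u - y)\<^sup>2 = u - d = a\<close>. The lower bound on
  \<open>a\<close> keeps all iterates below \<open>\<beta> *\<^sub>R u\<close> with
  \<open>\<beta> = 1 - \<epsilon> < 1\<close>, which makes the increments decay like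
  \<open>\<beta> ^ n\<close>.\<close>

lemma D_sqrt:
  assumes e: "0 < \<epsilon>" "\<epsilon> \<le> 1" and "\<epsilon> *\<^sub>R u \<le> a" "a \<le> u"
  shows "\<exists>s\<in>D. \<epsilon> *\<^sub>R u \<le> s \<and> S s s = a"
proof -
  define \<beta> where "\<beta> = 1 - \<epsilon>"
  have b: "0 \<le> \<beta>" "\<beta> < 1" using e by (auto simp: \<beta>_def)
  define d where "d = u - a"
  have d: "d \<in> D" "d \<le> \<beta> *\<^sub>R u" unfolding d_def \<beta>_def scaleR_left_diff_distrib
    using D_diff[OF D_unit D_self] assms by auto
  define Y where "Y n = ((\<lambda>y. (1/2) *\<^sub>R (d + S y y)) ^^ n) 0" for n
  have Y0: "Y 0 = 0" and YS: "Y (Suc n) = (1/2) *\<^sub>R (d + S (Y n) (Y n))" for n by (simp_all add: Y_def)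
  have zero: "0 \<in> D" using D_scale[OF D_unit, of 0] by simp
  have YD: "Y n \<in> D" for n
  proof (induction n)
    case 0 then show ?case by (simp add: Y0 zero)
  next
    case (Suc n) then show ?case unfolding YS by (intro D_scale D_add D_mult d) auto
  qed
  have Yn: "0 \<le> Y n" for n using YD by (rule D_nonneg)
  have Yb: "Y n \<le> \<beta> *\<^sub>R u" for n
  proof (induction n)
    case 0 then show ?case using b by (simp add: Y0 scaleR_nonneg_nonneg)
  next
    case (Suc n)
    have "S (Y n) (Y n) \<le> S (Y n) (\<beta> *\<^sub>R u)" by (intro S.mono_right Yn Suc)
    also have "\<dots> = \<beta> *\<^sub>R Y n" by (simp add: S.scale_right S.unit_right Yn)
    also have "\<dots> \<le> \<beta> *\<^sub>R (1 *\<^sub>R u)"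
      using b order_trans[OF Suc S.scaleR_u_mono[of \<beta> 1]] by (intro scaleR_left_mono) auto
    finally have "d + S (Y n) (Y n) \<le> \<beta> *\<^sub>R u + \<beta> *\<^sub>R u" using d(2) by (intro add_mono) auto
    then have "Y (Suc n) \<le> (1/2) *\<^sub>R (\<beta> *\<^sub>R u + \<beta> *\<^sub>R u)" unfolding YS by (intro scaleR_left_mono) auto
    then show ?case by (simp flip: scaleR_2)
  qed
  have Yu: "Y n \<le> u" for n
    using order_trans[OF Yb S.scaleR_u_mono[of \<beta> 1]] b by simp
  have inc: "0 \<le> Y (Suc n) - Y n \<and> Y (Suc n) - Y n \<le> \<beta> ^ n *\<^sub>R u" for n
  proof (induction n)
    case 0
    have "Y 1 \<le> u" by (rule Yu)
    then show ?case using Yn[of 1] by (simp add: Y0)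
  next
    case (Suc n)
    define y z where "y = Y n" and "z = Y (Suc n)"
    have yz: "y \<in> D" "z \<in> D" "0 \<le> y" "0 \<le> z" using YD Yn by (simp_all add: y_def z_def)
    have dl: "0 \<le> z - y" "z - y \<le> \<beta> ^ n *\<^sub>R u" using Suc by (simp_all add: y_def z_def)
    have dD: "z - y \<in> D" using dl yz by (intro D_diff) auto
    have bound: "0 \<le> S x (z - y) \<and> S x (z - y) \<le> \<beta> *\<^sub>R (z - y)" if x: "x \<in> D" "x \<le> \<beta> *\<^sub>R u" for x
    proof -
      have "S x (z - y) = S (z - y) x" by (rule D_comm[OF x(1) dD])
      also have "\<dots> \<le> S (z - y) (\<beta> *\<^sub>R u)" by (rule S.mono_right[OF dl(1) x(2)])
      also have "\<dots> = \<beta> *\<^sub>R (z - y)" by (simp only: S.scale_right[OF dl(1)] S.unit_right[OF dl(1)])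
      finally show ?thesis using S.nonneg[OF D_nonneg[OF x(1)] dl(1)] by simp
    qed
    have yb: "0 \<le> S y (z - y)" "S y (z - y) \<le> \<beta> *\<^sub>R (z - y)" "0 \<le> S z (z - y)" "S z (z - y) \<le> \<beta> *\<^sub>R (z - y)"
      using bound[of y] bound[of z] yz Yb by (simp_all add: y_def z_def)
    \<comment> \<open>The difference of squares factors because \<open>y\<close> and
      \<open>z\<close> commute. Each of \<open>y\<close> and \<open>z\<close> contributes a factor
      of at most \<open>\<beta>\<close>, and the half in the iteration averages the two.\<close>
    have "S z z - S y y = S z (z - y) + S y (z - y)"
      using D_comm(1)[OF yz(1,2)] by (simp add: S.diff_right yz)
    then have "Y (Suc (Suc n)) - Y (Suc n) = (1/2) *\<^sub>R (S z (z - y) + S y (z - y))"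
      by (simp add: YS[of "Suc n"] YS[of n] z_def y_def flip: scaleR_right_diff_distrib)
    moreover have "(1/2) *\<^sub>R (S z (z - y) + S y (z - y)) \<le> (1/2) *\<^sub>R (\<beta> *\<^sub>R (z - y) + \<beta> *\<^sub>R (z - y))"
      using yb by (intro scaleR_left_mono add_mono) auto
    moreover have "(1/2) *\<^sub>R (\<beta> *\<^sub>R (z - y) + \<beta> *\<^sub>R (z - y)) = \<beta> *\<^sub>R (z - y)"
      by (simp flip: scaleR_2)
    moreover have "\<beta> *\<^sub>R (z - y) \<le> \<beta> *\<^sub>R (\<beta> ^ n *\<^sub>R u)" using b dl by (intro scaleR_left_mono) auto
    moreover have "0 \<le> (1/2) *\<^sub>R (S z (z - y) + S y (z - y))"
      using yb by (intro scaleR_nonneg_nonneg) auto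
    ultimately show ?case by auto
  qed
  obtain y where y: "conv Y y" using geometric_conv[OF b, of Y] inc by auto
  have yD: "y \<in> D" by (rule D_conv[OF YD y])
  note y0 = D_nonneg[OF yD]
  have "conv (\<lambda>n. \<beta> *\<^sub>R u - Y n) (\<beta> *\<^sub>R u - y)" by (intro S.conv_diff S.conv_const y)
  then have "0 \<le> \<beta> *\<^sub>R u - y" by (rule S.conv_nonneg) (simp add: Yb)
  then have yb: "y \<le> \<beta> *\<^sub>R u" by simp
  then have yu: "y \<le> u" using order_trans[OF yb S.scaleR_u_mono[of \<beta> 1]] b by simp
  have "conv (\<lambda>n. Y (Suc n)) ((1/2) *\<^sub>R (d + S y y))"
    unfolding YS by (intro S.conv_scale S.conv_add S.conv_const S.conv_mult Yn Yu y y0) simp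
  then have yeq: "y = (1/2) *\<^sub>R (d + S y y)" using S.conv_Suc[OF y] S.conv_unique by blast
  have "2 *\<^sub>R y = d + S y y" by (subst yeq) simp
  then have y2: "y + y = d + S y y" by (simp add: scaleR_2)
  have sD: "u - y \<in> D" by (rule D_diff[OF D_unit yD yu])
  have "S (u - y) (u - y) = S (u - y) u - S (u - y) y" by (rule S.diff_right[OF D_nonneg[OF sD]])
  also have "\<dots> = (u - y) - S y (u - y)"
    by (simp only: S.unit_right[OF D_nonneg[OF sD]] D_comm[OF yD sD])
  also have "\<dots> = (u - y) - (y - S y y)" by (simp add: S.diff_right[OF y0] S.unit_right[OF y0])
  also have "\<dots> = u - (y + y) + S y y" by (simp add: algebra_simps)
  also have "\<dots> = a" unfolding y2 by (simp add: d_def)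
  finally have "S (u - y) (u - y) = a" .
  moreover have "\<epsilon> *\<^sub>R u \<le> u - y"
    using yb unfolding \<beta>_def scaleR_left_diff_distrib by (simp add: le_diff_eq add.commute)
  ultimately show ?thesis using sD by blast
qed

end

text \<open>A condition without reference to a product; it ensures an inverse common to
  \<open>S\<close> and \<open>T\<close> (\<open>common_inverse\<close>) and a square root
  (\<open>positive_definite_square\<close>).\<close>

definition positive_definite :: "'v \<Rightarrow> bool" where
  "positive_definite a \<longleftrightarrow> (\<exists>\<epsilon>>0. \<epsilon> *\<^sub>R u \<le> a)"

lemma positive_definite_nonneg: assumes "positive_definite a" shows "0 \<le> a"
proof -
  obtain e where "e > 0" "e *\<^sub>R u \<le> a" using assms positive_definite_def by blast
  moreover from this have "0 \<le> e *\<^sub>R u" by (intro scaleR_nonneg_nonneg) auto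
  ultimately show ?thesis by (meson order_trans)
qed

lemma positive_definite_scale:
  assumes "positive_definite a" "0 < r" shows "positive_definite (r *\<^sub>R a)"
proof -
  obtain e where e: "e > 0" "e *\<^sub>R u \<le> a" using assms positive_definite_def by blast
  then have "r *\<^sub>R (e *\<^sub>R u) \<le> r *\<^sub>R a" using assms by (intro scaleR_left_mono) auto
  then show ?thesis unfolding positive_definite_def using assms e by (intro exI[of _ "r * e"]) auto
qed

lemma positive_definite_normalize:
  assumes "positive_definite a"
  obtains r b \<epsilon> where "0 < r" "0 < \<epsilon>" "\<epsilon> \<le> 1" "a = r *\<^sub>R b" "0 \<le> b" "b \<le> u" "\<epsilon> *\<^sub>R u \<le> b"
proof -
  obtain r b where r: "r \<ge> 1" "b \<in> {0..u}" "a = r *\<^sub>R b"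
    using S.nonneg_scale_unit_interval[OF positive_definite_nonneg[OF assms]] .
  have "b = inverse r *\<^sub>R a" using r by simp
  then have "positive_definite b" using positive_definite_scale[OF assms, of "inverse r"] r by simp
  then obtain e where e: "e > 0" "e *\<^sub>R u \<le> b" using positive_definite_def by blast
  have "min e 1 *\<^sub>R u \<le> e *\<^sub>R u" by (intro S.scaleR_u_mono) simp
  with e have "min e 1 *\<^sub>R u \<le> b" by (meson order_trans)
  then show ?thesis using r e by (intro that[of r "min e 1" b]) auto
qed

text \<open>The inverse is constructed inside a joint bicommutant, where both products commute and
  agree, so it serves both at once.\<close>

lemma common_inverse:
  assumes "positive_definite a"
  obtains c where "positive_definite c" "S.is_inverse a c" "T.is_inverse a c"
proof -
  obtain r b e where r: "0 < r" "0 < e" "e \<le> 1" "a = r *\<^sub>R b" "0 \<le> b" "b \<le> u" "e *\<^sub>R u \<le> b"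
    using positive_definite_normalize[OF assms] .
  have "u - b \<le> (1 - e) *\<^sub>R u" using r(7) by (simp add: scaleR_left_diff_distrib)
  then obtain c where c: "c \<in> joint_bicommutant b" "S b c = u"
    using D_inverse[OF r(5), of "1 - e"] r by auto
  note bb = D_self[OF r(5)]
  have c0: "0 \<le> c" by (rule D_nonneg[OF r(5) c(1)])
  have cs: "S c b = u" "T b c = u" "T c b = u"
    using D_comm[OF r(5) bb c(1)] D_agree[OF r(5) bb c(1)] c(2) by auto
  \<comment> \<open>From \<open>b \<le> u\<close> follows \<open>u = S c b \<le> S c u = c\<close>,
    so the inverse is positive definite as well.\<close>
  have "S c b \<le> S c u" using r c0 by (intro S.mono_right) auto
  then have "u \<le> c" using cs c0 by (simp add: S.unit_right)
  then have "positive_definite c" unfolding positive_definite_def by (intro exI[of _ 1]) simp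
  then have "positive_definite (inverse r *\<^sub>R c)" using r by (intro positive_definite_scale) auto
  moreover have "0 \<le> inverse r *\<^sub>R c" using c0 r by (intro scaleR_nonneg_nonneg) auto
  then have "S.is_inverse a (inverse r *\<^sub>R c)" "T.is_inverse a (inverse r *\<^sub>R c)"
    unfolding S.is_inverse_def T.is_inverse_def r(4) using r c0 c(2) cs
    by (simp_all add: S.scale_left T.scale_left S.scale_right T.scale_right)
  ultimately show ?thesis by (rule that)
qed

lemma positive_definite_square:
  assumes "positive_definite a"
  obtains s where "positive_definite s" "S s s = a"
proof -
  obtain r b e where r: "0 < r" "0 < e" "e \<le> 1" "a = r *\<^sub>R b" "0 \<le> b" "b \<le> u" "e *\<^sub>R u \<le> b"
    using positive_definite_normalize[OF assms] .
  obtain s where s: "s \<in> joint_bicommutant b" "e *\<^sub>R u \<le> s" "S s s = b"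
    using D_sqrt[OF r(5,2,3,7,6)] by (elim bexE conjE)
  have s0: "0 \<le> s" by (rule D_nonneg[OF r(5) s(1)])
  have "positive_definite s" unfolding positive_definite_def using r(2) s(2) by (intro exI[of _ e]) simp
  then have "positive_definite (sqrt r *\<^sub>R s)" using r by (intro positive_definite_scale) auto
  moreover have "S (sqrt r *\<^sub>R s) (sqrt r *\<^sub>R s) = a"
    using r s s0 by (simp add: S.scale_left S.scale_right)
  ultimately show ?thesis by (rule that)
qed

lemma T_inverse_S_inverse:
  assumes "positive_definite a" "T.is_inverse a c" shows "S.is_inverse a c"
  using common_inverse[OF assms(1)] T.is_inverse_unique[OF positive_definite_nonneg[OF assms(1)] assms(2)]
  by metis

text \<open>The inverse map is \<open>\<lambda>w. T c (S s w)\<close>. All four multiplications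
  involved are positive, so the order is preserved both ways, and
  \<open>S c (T s u) = S c s = u\<close>.\<close>

lemma comparison_iso:
  assumes s: "0 \<le> s" "S.is_inverse s c" "T.is_inverse s c"
  shows "unital_order_iso u (\<lambda>w. S c (T s w))"
  unfolding unital_order_iso_def
proof (intro conjI allI)
  have c: "0 \<le> c" using s by (simp add: S.is_inverse_def)
  show "linear (\<lambda>w. S c (T s w))"
    using linear_compose[OF T.linear[OF s(1)] S.linear[OF c]] by (simp add: o_def)
  show "bij (\<lambda>w. S c (T s w))"
    by (rule o_bij[where g = "\<lambda>w. T c (S s w)"])
      (auto simp: o_def S.is_inverse_cancel[OF s(1,2)] T.is_inverse_cancel[OF s(1,3)])
  show "S c (T s u) = u" using s by (simp add: T.unit_right S.is_inverse_def)
  show "0 \<le> v \<longleftrightarrow> 0 \<le> S c (T s v)" for v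
  proof
    assume "0 \<le> S c (T s v)"
    from T.nonneg[OF c S.nonneg[OF s(1) this]] have "0 \<le> T c (S s (S c (T s v)))" .
    then show "0 \<le> v" by (simp add: S.is_inverse_cancel[OF s(1,2)] T.is_inverse_cancel[OF s(1,3)])
  next
    assume "0 \<le> v" then show "0 \<le> S c (T s v)" by (intro S.nonneg T.nonneg s c)
  qed
qed

text \<open>
  With \<open>\<Phi> = S s\<inverse> \<circ> T s\<close> and \<open>\<Psi> = S s \<circ> T s\<inverse>\<close>, preservation of inverses yields \<open>\<Phi> = \<Psi>\<close>
  and invariance of \<open>S\<close> yields \<open>\<Psi> \<circ> \<Phi> = id\<close>; hence \<open>T s \<circ> T s = S s \<circ> S s\<close>.
\<close>

lemma agree_on_square:
  assumes invariant: "\<And>\<Phi> x y. unital_order_iso u \<Phi> \<Longrightarrow> 0 \<le> x \<Longrightarrow> 0 \<le> y \<Longrightarrow> \<Phi> (S x y) = S (\<Phi> x) (\<Phi> y)"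
    and S_inv: "\<And>a b c d. 0 \<le> a \<Longrightarrow> 0 \<le> b \<Longrightarrow> S.is_inverse a c \<Longrightarrow> S.is_inverse b d \<Longrightarrow>
      S.is_inverse (S a b) (S c d)"
    and T_inv: "\<And>a b c d. 0 \<le> a \<Longrightarrow> 0 \<le> b \<Longrightarrow> T.is_inverse a c \<Longrightarrow> T.is_inverse b d \<Longrightarrow>
      T.is_inverse (T a b) (T c d)"
    and s: "positive_definite s" and w: "0 \<le> w"
  shows "T (S s s) w = S (S s s) w"
proof -
  have s0: "0 \<le> s" by (rule positive_definite_nonneg[OF s])
  obtain c where c: "positive_definite c" "S.is_inverse s c" "T.is_inverse s c"
    using common_inverse[OF s] .
  have c0: "0 \<le> c" by (rule positive_definite_nonneg[OF c(1)])
  have c': "S.is_inverse c s" "T.is_inverse c s"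
    using c s0 by (auto simp: S.is_inverse_def T.is_inverse_def)
  define \<Phi> where "\<Phi> = (\<lambda>w. S c (T s w))"
  define \<Psi> where "\<Psi> = (\<lambda>w. S s (T c w))"
  have \<Phi>: "unital_order_iso u \<Phi>" unfolding \<Phi>_def by (rule comparison_iso[OF s0 c(2,3)])
  have \<Psi>: "unital_order_iso u \<Psi>" unfolding \<Psi>_def by (rule comparison_iso[OF c0 c'])
  have \<Phi>0: "0 \<le> \<Phi> w" and \<Psi>0: "0 \<le> \<Psi> w" if "0 \<le> w" for w
    using \<Phi> \<Psi> that by (auto simp: unital_order_iso_def)
  have lin: "linear \<Phi>" "linear \<Psi>" and unital: "\<Phi> u = u" "\<Psi> u = u"
    using \<Phi> \<Psi> by (auto simp: unital_order_iso_def)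
  have Ts: "T s w = S s (\<Phi> w)" for w by (simp add: \<Phi>_def S.is_inverse_cancel[OF s0 c(2)])
  have Tc: "T c w = S c (\<Psi> w)" for w by (simp add: \<Psi>_def S.is_inverse_cancel[OF s0 c(2)])
  \<comment> \<open>With \<open>b\<close> the inverse of \<open>e\<close>, the element
    \<open>T s b = S s (\<Phi> b)\<close> has its inverse described twice: as \<open>T c e\<close>
    by \<open>T_inv\<close> and as \<open>S c (\<Phi> e)\<close> by \<open>S_inv\<close>. Comparing
    them gives \<open>S c (\<Psi> e) = S c (\<Phi> e)\<close>.\<close>
  have pd: "\<Phi> e = \<Psi> e" if e: "positive_definite e" for e
  proof -
    have e0: "0 \<le> e" by (rule positive_definite_nonneg[OF e])
    obtain b where b: "positive_definite b" "S.is_inverse e b" "T.is_inverse e b"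
      using common_inverse[OF e] .
    have b0: "0 \<le> b" by (rule positive_definite_nonneg[OF b(1)])
    have be: "S.is_inverse b e" "T.is_inverse b e"
      using b e0 by (auto simp: S.is_inverse_def T.is_inverse_def)
    \<comment> \<open>\<open>T_inv\<close> only yields a \<open>T\<close>-inverse; positive
      definiteness makes it the \<open>S\<close>-inverse too.\<close>
    have "positive_definite (T s b)"
    proof -
      obtain r where r: "r > 0" "r *\<^sub>R u \<le> b" using b positive_definite_def by blast
      have "r *\<^sub>R s \<le> T s b"
        using T.mono_right[OF s0 r(2)] by (simp add: T.scale_right T.unit_right s0)
      moreover have "positive_definite (r *\<^sub>R s)" by (rule positive_definite_scale[OF s r(1)])
      ultimately show ?thesis unfolding positive_definite_def by (meson order_trans)
    qed
    moreover have "T.is_inverse (T s b) (T c e)" by (rule T_inv[OF s0 b0 c(3) be(2)])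
    ultimately have 1: "S.is_inverse (T s b) (T c e)" by (rule T_inverse_S_inverse)
    have "S (\<Phi> b) (\<Phi> e) = \<Phi> (S b e)" "S (\<Phi> e) (\<Phi> b) = \<Phi> (S e b)"
      using invariant[OF \<Phi> b0 e0] invariant[OF \<Phi> e0 b0] by simp_all
    then have "S.is_inverse (\<Phi> b) (\<Phi> e)"
      using be(1) \<Phi>0[OF e0] unital by (simp add: S.is_inverse_def)
    then have "S.is_inverse (S s (\<Phi> b)) (S c (\<Phi> e))" by (rule S_inv[OF s0 \<Phi>0[OF b0] c(2)])
    then have "S c (\<Phi> e) = T c e"
      using 1 S.is_inverse_unique[OF T.nonneg[OF s0 b0]] by (simp add: Ts)
    then have "S s (S c (\<Phi> e)) = S s (S c (\<Psi> e))" by (simp add: Tc)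
    then show ?thesis by (simp add: S.is_inverse_cancel[OF s0 c(2)])
  qed
  have "\<Phi> = \<Psi>"
  proof
    fix w
    \<comment> \<open>A large multiple of \<open>u\<close> added to \<open>w\<close> makes it
      positive definite, and both maps fix \<open>u\<close>.\<close>
    obtain r where "r > 0" "- (r *\<^sub>R u) \<le> w" using S.order_unit_real by blast
    then have "1 *\<^sub>R u \<le> w + (r + 1) *\<^sub>R u"
      using add_mono[of "- (r *\<^sub>R u)" w "r *\<^sub>R u + u" "r *\<^sub>R u + u"] by (simp add: scaleR_left_distrib)
    then have "positive_definite (w + (r + 1) *\<^sub>R u)" unfolding positive_definite_def by (meson zero_less_one)
    from pd[OF this] show "\<Phi> w = \<Psi> w"
      using unital by (simp add: linear_add[OF lin(1)] linear_add[OF lin(2)] linear_scale[OF lin(1)] linear_scale[OF lin(2)])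
  qed
  \<comment> \<open>Because \<open>\<Psi>\<close> fixes \<open>s\<close>, invariance lets it pass
    through \<open>S s\<close>.\<close>
  have \<Psi>s: "\<Psi> s = s" using c' s0 by (simp add: \<Psi>_def S.unit_right T.is_inverse_def)
  have inv: "\<Psi> (\<Phi> w) = w"
  proof -
    have "w = T c (T s w)" by (simp add: T.is_inverse_cancel[OF s0 c(3)])
    also have "\<dots> = S c (\<Psi> (S s (\<Phi> w)))" by (simp only: Tc Ts)
    also have "\<dots> = S c (S s (\<Psi> (\<Phi> w)))" using invariant[OF \<Psi> s0 \<Phi>0[OF w]] by (simp add: \<Psi>s)
    also have "\<dots> = \<Psi> (\<Phi> w)" by (simp add: S.is_inverse_cancel[OF s0 c(2)])
    finally show ?thesis by simp
  qed
  \<comment> \<open>The squares of \<open>s\<close> under \<open>S\<close> and \<open>T\<close>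
    coincide, so \<open>T (S s s)\<close> is \<open>T s\<close> applied twice.\<close>
  have "T (S s s) w = T s (T s w)" using T.assoc[OF s0 s0 refl] squares[OF s0] by simp
  also have "\<dots> = S s (\<Psi> (S s (\<Phi> w)))" by (simp add: Ts \<open>\<Phi> = \<Psi>\<close>)
  also have "\<dots> = S s (S s (\<Psi> (\<Phi> w)))" using invariant[OF \<Psi> s0 \<Phi>0[OF w]] by (simp add: \<Psi>s)
  also have "\<dots> = S (S s s) w" using inv S.assoc[OF s0 s0 refl] by simp
  finally show ?thesis .
qed

text \<open>Adding \<open>u / (n + 1)\<close> makes \<open>a\<close> positive definite, hence the
  square of a positive definite element; continuity in the first factor removes the
  perturbation.\<close>

theorem agree:
  assumes invariant: "\<And>\<Phi> x y. unital_order_iso u \<Phi> \<Longrightarrow> 0 \<le> x \<Longrightarrow> 0 \<le> y \<Longrightarrow> \<Phi> (S x y) = S (\<Phi> x) (\<Phi> y)"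
    and S_inv: "\<And>a b c d. 0 \<le> a \<Longrightarrow> 0 \<le> b \<Longrightarrow> S.is_inverse a c \<Longrightarrow> S.is_inverse b d \<Longrightarrow>
      S.is_inverse (S a b) (S c d)"
    and T_inv: "\<And>a b c d. 0 \<le> a \<Longrightarrow> 0 \<le> b \<Longrightarrow> T.is_inverse a c \<Longrightarrow> T.is_inverse b d \<Longrightarrow>
      T.is_inverse (T a b) (T c d)"
    and a: "0 \<le> a" and w: "0 \<le> w"
  shows "S a w = T a w"
proof -
  define X where "X n = a + inverse (real (Suc n)) *\<^sub>R u" for n
  have X0: "0 \<le> X n" for n unfolding X_def using a by (intro add_nonneg_nonneg scaleR_nonneg_nonneg) auto
  have X: "conv X a"
  proof (rule S.conv_real_bound[OF LIMSEQ_inverse_real_of_nat])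
    fix n
    have "0 \<le> inverse (real (Suc n)) *\<^sub>R u" by (intro scaleR_nonneg_nonneg) auto
    then show "- (inverse (real (Suc n)) *\<^sub>R u) \<le> X n - a" "X n - a \<le> inverse (real (Suc n)) *\<^sub>R u"
      unfolding X_def by (auto intro: order_trans[of _ 0])
  qed
  have "S (X n) w = T (X n) w" for n
  proof -
    have "positive_definite (X n)" unfolding positive_definite_def X_def
      using a by (intro exI[of _ "inverse (real (Suc n))"]) simp
    then obtain s where "positive_definite s" "S s s = X n" by (rule positive_definite_square)
    then show ?thesis using agree_on_square[OF invariant S_inv T_inv _ w, of s] by simp
  qed
  then have "conv (\<lambda>n. T (X n) w) (S a w)" using S.conv_left[OF X0 a X w] by simp
  then show ?thesis using T.conv_left[OF X0 a X w] S.conv_unique by blast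
qed

end

section \<open>From the unit interval to the cone\<close>

context order_unit_space
begin

text \<open>A lower bound \<open>l\<close> outside \<open>E\<close> cannot be tested directly. The
  affine bijection \<open>h\<close> carries the interval from \<open>- (r *\<^sub>R u)\<close> to
  \<open>u\<close>, which contains \<open>l\<close>, onto \<open>E\<close>; there the transported
  sequence has an infimum, and pulled back it is at most \<open>i\<close>.\<close>

lemma relative_inf_is_inf:
  assumes ex: "\<And>Y. (\<And>n. Y n \<in> E) \<Longrightarrow> decseq Y \<Longrightarrow>
      \<exists>j\<in>E. (\<forall>n. j \<le> Y n) \<and> (\<forall>l\<in>E. (\<forall>n. l \<le> Y n) \<longrightarrow> l \<le> j)"
    and X: "\<And>n. X n \<in> E" "decseq X"
    and i: "i \<in> E" "\<And>n. i \<le> X n" "\<And>l. l \<in> E \<Longrightarrow> (\<And>n. l \<le> X n) \<Longrightarrow> l \<le> i"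
  shows "is_inf X i"
  unfolding is_inf_def
proof (intro conjI allI impI)
  fix l assume l: "\<forall>n. l \<le> X n"
  obtain r where r: "r > 0" "- (r *\<^sub>R u) \<le> l" using order_unit_real by blast
  define h where "h v = inverse (1 + r) *\<^sub>R (v + r *\<^sub>R u)" for v
  have h_mono: "h v \<le> h w \<longleftrightarrow> v \<le> w" for v w
  proof
    assume "h v \<le> h w"
    then have "(1 + r) *\<^sub>R h v \<le> (1 + r) *\<^sub>R h w" using r by (intro scaleR_left_mono) auto
    then show "v \<le> w" using r by (simp add: h_def)
  next
    assume "v \<le> w" then show "h v \<le> h w"
      unfolding h_def using r by (intro scaleR_left_mono) auto
  qed
  have hu: "h u = u"
  proof -
    have "u + r *\<^sub>R u = (1 + r) *\<^sub>R u" by (simp add: scaleR_left_distrib)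
    then show ?thesis using r by (simp add: h_def)
  qed
  have hr: "h (- (r *\<^sub>R u)) = 0" by (simp add: h_def)
  have h_E: "h v \<in> E" if "- (r *\<^sub>R u) \<le> v" "v \<le> u" for v
    using that h_mono[of "- (r *\<^sub>R u)" v] h_mono[of v u] hu hr by simp
  have "- (r *\<^sub>R u) \<le> 0" using r by (simp add: scaleR_nonneg_nonneg)
  note neg_trans = order_trans[OF this]
  have neg: "- (r *\<^sub>R u) \<le> v" if "v \<in> E" for v using that by (intro neg_trans) simp
  have "h (X n) \<in> E" for n using X(1) by (intro h_E neg) auto
  moreover have "decseq (\<lambda>n. h (X n))" using X(2) by (simp add: decseq_def h_mono)
  ultimately obtain j where j: "\<And>n. j \<le> h (X n)" "\<And>l. l \<in> E \<Longrightarrow> (\<And>n. l \<le> h (X n)) \<Longrightarrow> l \<le> j"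
    using ex[of "\<lambda>n. h (X n)"] by blast
  define k where "k = (1 + r) *\<^sub>R j - r *\<^sub>R u"
  have hk: "h k = j" using r by (simp add: h_def k_def)
  have kX: "k \<le> X n" for n using j(1)[of n] h_mono[of k "X n"] hk by simp
  have "h i \<le> j" using i(1,2) by (intro j(2) h_E neg) (auto simp: h_mono)
  then have "i \<le> k" using h_mono[of i k] hk by simp
  then have "k \<in> E" using i(1) kX[of 0] X(1)[of 0] by (auto intro: order_trans)
  then have "k \<le> i" using kX by (rule i(3))
  moreover have "l \<le> u" using l X(1)[of 0] by (auto intro: order_trans)
  then have "h l \<le> j" using l r(2) by (intro j(2) h_E) (auto simp: h_mono)
  then have "l \<le> k" using h_mono[of l k] hk by simp
  ultimately show "l \<le> i" by simp
qed (rule i(2))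

end

section \<open>Completeness from infima of descending sequences\<close>

context normal_ou_product
begin

text \<open>An infimum is only an order limit; the geometric bound on the tails makes it a norm
  limit. To have one, the increasing sequence is reversed and rescaled into the descending
  \<open>Y\<close> in \<open>E\<close>.\<close>

lemma geometric_conv:
  assumes q: "0 \<le> q" "q < 1" and X: "\<And>n. X n \<le> X (Suc n)" "\<And>n. X (Suc n) - X n \<le> q ^ n *\<^sub>R u"
  shows "\<exists>x. conv X x"
proof -
  \<comment> \<open>The sum of the geometric series; \<open>K * q + 1 = K\<close> is what makes the
    tail bounds telescope.\<close>
  define K where "K = 1 / (1 - q)"
  have K: "K > 0" "K * q + 1 = K" using q by (auto simp: K_def field_simps)
  have inc: "X n \<le> X m" if "n \<le> m" for n m
    using incseq_SucI[of X] X(1) that by (auto simp: incseq_def)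
  have tail: "X (n + k) - X n \<le> (K * q ^ n) *\<^sub>R u - (K * q ^ (n + k)) *\<^sub>R u" for n k
  proof (induction k)
    case (Suc k)
    have "X (n + Suc k) - X n = (X (n + k) - X n) + (X (Suc (n + k)) - X (n + k))" by simp
    also have "\<dots> \<le> ((K * q ^ n) *\<^sub>R u - (K * q ^ (n + k)) *\<^sub>R u) + q ^ (n + k) *\<^sub>R u"
      by (intro add_mono Suc X)
    also have "K * q ^ (n + k) = (K * q + 1) * q ^ (n + k)" by (simp only: K)
    also have "\<dots> = K * q ^ (n + Suc k) + q ^ (n + k)" by (simp add: algebra_simps)
    finally show ?case by (simp add: scaleR_left_distrib)
  qed simp
  have tail': "X m - X n \<le> (K * q ^ n) *\<^sub>R u" if "n \<le> m" for n m
  proof -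
    have "0 \<le> (K * q ^ m) *\<^sub>R u" using q K by (intro scaleR_nonneg_nonneg) auto
    then have "(K * q ^ n) *\<^sub>R u - (K * q ^ m) *\<^sub>R u \<le> (K * q ^ n) *\<^sub>R u" by simp
    then show ?thesis using tail[of n "m - n"] that by (auto intro: order_trans)
  qed
  define Y where "Y n = u - inverse K *\<^sub>R (X n - X 0)" for n
  have Y: "X n = X 0 + K *\<^sub>R (u - Y n)" for n using K by (simp add: Y_def)
  have YE: "Y n \<in> E" for n
  proof -
    have "inverse K *\<^sub>R (X n - X 0) \<le> inverse K *\<^sub>R (K *\<^sub>R u)"
      using tail'[of 0 n] K by (intro scaleR_left_mono) auto
    moreover have "0 \<le> inverse K *\<^sub>R (X n - X 0)"
      using inc[of 0 n] K by (intro scaleR_nonneg_nonneg) auto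
    ultimately show ?thesis using K by (simp add: Y_def)
  qed
  have dY: "decseq Y"
    unfolding decseq_def Y_def using inc K by (auto intro!: diff_mono scaleR_left_mono)
  obtain i where i: "is_inf Y i" using ex_inf[OF YE dY] by blast
  have Yi: "Y n - i \<le> q ^ n *\<^sub>R u" for n
  proof -
    have "Y n - q ^ n *\<^sub>R u \<le> Y m" for m
    proof (cases "n \<le> m")
      case True
      have "Y n - Y m = inverse K *\<^sub>R (X m - X n)" by (simp add: Y_def scaleR_right_diff_distrib)
      also have "\<dots> \<le> inverse K *\<^sub>R ((K * q ^ n) *\<^sub>R u)"
        using tail'[OF True] K by (intro scaleR_left_mono) auto
      also have "\<dots> = q ^ n *\<^sub>R u" using K by simp
      finally show ?thesis by (simp add: diff_le_eq add.commute)
    next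
      case False
      then have "Y n \<le> Y m" using dY by (simp add: decseq_def)
      moreover have "0 \<le> q ^ n *\<^sub>R u" using q by (intro scaleR_nonneg_nonneg) auto
      ultimately show ?thesis by (simp add: diff_le_eq add_increasing2)
    qed
    then have "Y n - q ^ n *\<^sub>R u \<le> i" by (rule is_inf_greatest[OF i])
    then show ?thesis by (simp add: diff_le_eq add.commute)
  qed
  define x where "x = X 0 + K *\<^sub>R (u - i)"
  have diff: "X n - x = - (K *\<^sub>R (Y n - i))" for n
    by (subst Y) (simp add: x_def scaleR_right_diff_distrib)
  have "conv X x"
  proof (rule conv_real_bound)
    show "(\<lambda>n. K * q ^ n) \<longlonglongrightarrow> 0"
      using tendsto_mult_right_zero[OF LIMSEQ_realpow_zero[OF q]] .
    fix n
    have "K *\<^sub>R (Y n - i) \<le> K *\<^sub>R (q ^ n *\<^sub>R u)" using K Yi by (intro scaleR_left_mono) auto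
    then show "- ((K * q ^ n) *\<^sub>R u) \<le> X n - x" unfolding diff by simp
    have "0 \<le> K *\<^sub>R (Y n - i)" using K is_inf_lower[OF i] by (intro scaleR_nonneg_nonneg) auto
    moreover have "0 \<le> (K * q ^ n) *\<^sub>R u" using q K by (intro scaleR_nonneg_nonneg) auto
    ultimately show "X n - x \<le> (K * q ^ n) *\<^sub>R u" unfolding diff by (meson neg_le_0_iff_le order_trans)
  qed
  then show ?thesis by blast
qed

end

text \<open>Products of digits are determined by the order (\<open>splits_value\<close>), so
  \<open>P\<close> and \<open>Q\<close> agree on finite binary sums; \<open>square_conv\<close>
  carries this to \<open>a\<close>.\<close>

lemma squares_agree:
  fixes u :: "'v::ordered_real_vector"
  assumes "continuous_product u P" "continuous_product u Q" and a: "a \<in> {0..u}"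
  shows "P a a = Q a a"
proof -
  interpret P: continuous_product u P by fact
  interpret Q: continuous_product u Q by fact
  obtain p b where b: "b 0 = a" "\<And>n. b n \<in> {0..u}" "\<And>n. P.sharp (p n)"
      "\<And>n. 2 *\<^sub>R b n = p n + b (Suc n)" "\<And>m n. P.splits (p m) (p n)"
    using P.dyadic[OF a] unfolding P.dyadic_def by blast
  define r :: "nat \<Rightarrow> real" where "r n = (1/2) ^ n" for n
  have r: "0 \<le> r n" "r n \<le> 1" for n by (auto simp: r_def power_le_one)
  have r_lim: "r \<longlonglongrightarrow> 0" unfolding r_def by (rule LIMSEQ_realpow_zero) auto
  have pE: "p n \<in> {0..u}" for n using b(3) P.sharp_def by blast
  \<comment> \<open>The sum of the \<open>r (k + 1) *\<^sub>R p k\<close> with \<open>k < n\<close>,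
    written as \<open>a\<close> minus its remainder so that \<open>square_conv\<close> fits.\<close>
  define s where "s n = a - r n *\<^sub>R b n" for n
  have as: "a = s n + r n *\<^sub>R b n" for n by (simp add: s_def)
  have s0: "s 0 = 0" by (simp add: s_def r_def b)
  have sSuc: "s (Suc n) = s n + r (Suc n) *\<^sub>R p n" for n
  proof -
    have "r n *\<^sub>R b n = r (Suc n) *\<^sub>R (2 *\<^sub>R b n)" by (simp add: r_def)
    then have "r n *\<^sub>R b n = r (Suc n) *\<^sub>R p n + r (Suc n) *\<^sub>R b (Suc n)"
      by (simp only: b(4) scaleR_right_distrib)
    then show ?thesis by (simp add: s_def)
  qed
  have rb: "r n *\<^sub>R b n \<in> {0..u}" and rp: "r (Suc n) *\<^sub>R p n \<in> {0..u}" for n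
    using P.scale_in_E[OF r b(2)] P.scale_in_E[OF r pE] by blast+
  have sE: "s n \<in> {0..u}" for n
  proof -
    have "0 \<le> s n"
      by (induction n) (use s0 sSuc rp in auto)
    moreover have "s n \<le> a" using rb[of n] by (simp add: s_def)
    ultimately show ?thesis using a by (auto intro: order_trans)
  qed
  have pp: "P (p m) (p n) = Q (p m) (p n)" for m n
    using b(5)[of m n] P.splits_value[OF b(3)] Q.splits_value[OF b(3)] unfolding P.splits_def by metis
  have P_step: "P (s k) (s (Suc n)) = P (s k) (s n) + r (Suc n) *\<^sub>R P (s k) (p n)"
    and Q_step: "Q (s k) (s (Suc n)) = Q (s k) (s n) + r (Suc n) *\<^sub>R Q (s k) (p n)" for k n
    using P.add_right[OF sE sE rp, of n n k] Q.add_right[OF sE sE rp, of n n k] sE[of "Suc n"]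
      P.scale_right[OF sE[of k] pE[of n] r[of "Suc n"]] Q.scale_right[OF sE[of k] pE[of n] r[of "Suc n"]] by (simp_all add: sSuc)
  \<comment> \<open>Additivity acts on the second argument only, so \<open>P (s n) (p m)\<close> is
    reached by commuting it to \<open>P (p m) (s n)\<close>; the commutation is carried along in the
    induction.\<close>
  have ps: "P (p m) (s n) = Q (p m) (s n) \<and> P (p m) (s n) = P (s n) (p m) \<and> Q (p m) (s n) = Q (s n) (p m)" for m n
  proof (induction n)
    case 0 then show ?case using pE[of m] by (simp add: s0 P.zero_right Q.zero_right P.zero_left Q.zero_left)
  next
    case (Suc n)
    note E = pE[of m] sE[of n] rp[of n] sE[of "Suc n", unfolded sSuc]
    have 1: "P (p m) (r (Suc n) *\<^sub>R p n) = r (Suc n) *\<^sub>R P (p m) (p n)"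
      "Q (p m) (r (Suc n) *\<^sub>R p n) = r (Suc n) *\<^sub>R Q (p m) (p n)"
      by (intro P.scale_right Q.scale_right pE r)+
    have 2: "P (r (Suc n) *\<^sub>R p n) (p m) = r (Suc n) *\<^sub>R P (p n) (p m)"
      "Q (r (Suc n) *\<^sub>R p n) (p m) = r (Suc n) *\<^sub>R Q (p n) (p m)"
      by (intro P.scale_left Q.scale_left pE r)+
    have 3: "P (p m) (p n) = P (p n) (p m)" "Q (p m) (p n) = Q (p n) (p m)"
      by (intro P.splits_comm Q.splits_comm b pE)+
    have 4: "P (p m) (r (Suc n) *\<^sub>R p n) = P (r (Suc n) *\<^sub>R p n) (p m)"
      "Q (p m) (r (Suc n) *\<^sub>R p n) = Q (r (Suc n) *\<^sub>R p n) (p m)"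
      by (simp_all only: 1 2 3)
    have "P (p m) (s n + r (Suc n) *\<^sub>R p n) = P (s n + r (Suc n) *\<^sub>R p n) (p m)"
      by (rule P.comm_add[OF E(2,3,1,4)]) (use Suc 4 in auto)
    moreover have "Q (p m) (s n + r (Suc n) *\<^sub>R p n) = Q (s n + r (Suc n) *\<^sub>R p n) (p m)"
      by (rule Q.comm_add[OF E(2,3,1,4)]) (use Suc 4 in auto)
    moreover have "P (p m) (s n + r (Suc n) *\<^sub>R p n) = Q (p m) (s n + r (Suc n) *\<^sub>R p n)"
      using P.add_right[OF E] Q.add_right[OF E] Suc 1 pp by simp
    ultimately show ?case unfolding sSuc by blast
  qed
  have ss: "P (s k) (s n) = Q (s k) (s n)" for k n
  proof (induction n)
    case 0 then show ?case using sE[of k] by (simp add: s0 P.zero_right Q.zero_right)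
  next
    case (Suc n) have "P (s k) (p n) = Q (s k) (p n)" using ps[of n k] by metis
    then show ?case using Suc by (simp add: P_step Q_step)
  qed
  have conv: "P.conv s a"
  proof (rule P.conv_real_bound[OF r_lim])
    fix n
    have le: "r n *\<^sub>R b n \<le> r n *\<^sub>R u" using r b(2)[of n] by (intro scaleR_left_mono) auto
    then show "- (r n *\<^sub>R u) \<le> s n - a" by (simp add: s_def)
    have "s n - a \<le> 0" using rb[of n] by (simp add: s_def)
    moreover have "0 \<le> r n *\<^sub>R u" using r by (intro scaleR_nonneg_nonneg) auto
    ultimately show "s n - a \<le> r n *\<^sub>R u" by (rule order_trans)
  qed
  have r': "0 \<le> r n \<and> r n \<le> 1" for n using r by blast
  have "P.conv (\<lambda>n. P (s n) (s n)) (P a a)" by (rule P.square_conv[OF sE a conv r_lim r' b(2) as])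
  moreover have "P.conv (\<lambda>n. Q (s n) (s n)) (Q a a)" by (rule Q.square_conv[OF sE a conv r_lim r' b(2) as])
  ultimately show ?thesis by (simp add: ss P.conv_unique)
qed

section \<open>Extension of a continuous product to the cone\<close>

context continuous_product
begin

definition extension :: "'v \<Rightarrow> 'v \<Rightarrow> 'v" where
  "extension a = (THE L. linear L \<and> (\<forall>b\<in>E. L b = P a b))"

lemma extension_ex1:
  assumes "a \<in> E" shows "\<exists>!L. linear L \<and> (\<forall>b\<in>E. L b = P a b)"
proof (rule ex_ex1I)
  show "\<exists>L. linear L \<and> (\<forall>b\<in>E. L b = P a b)"
    by (rule linear_extension) (simp_all del: atLeastAtMost_iff add: assms add_right scale_right)
qed (auto intro!: linear_eq_on_interval)

lemma extension_linear: "a \<in> E \<Longrightarrow> linear (extension a)"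
  and extension_eq: "a \<in> E \<Longrightarrow> b \<in> E \<Longrightarrow> extension a b = P a b"
  using theI'[OF extension_ex1] unfolding extension_def by blast+

lemma extension_scale:
  assumes "a \<in> E" "0 \<le> t" "t \<le> 1"
  shows "extension (t *\<^sub>R a) w = t *\<^sub>R extension a w"
proof -
  have ta: "t *\<^sub>R a \<in> E" using scale_in_E assms by blast
  have "linear (\<lambda>w. t *\<^sub>R extension a w)"
    using linear_compose_scale_right[OF extension_linear[OF assms(1)]] .
  then have "extension (t *\<^sub>R a) = (\<lambda>w. t *\<^sub>R extension a w)"
    by (rule linear_eq_on_interval[OF extension_linear[OF ta]])
      (simp del: atLeastAtMost_iff add: extension_eq ta assms scale_left)
  then show ?thesis by metis
qed

definition cone_mult :: "'v \<Rightarrow> 'v \<Rightarrow> 'v" where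
  "cone_mult v w = ou_norm u v *\<^sub>R extension (inverse (ou_norm u v) *\<^sub>R v) w"

lemma normalize_in_E: assumes "0 \<le> v" shows "inverse (ou_norm u v) *\<^sub>R v \<in> E"
proof (cases "ou_norm u v = 0")
  case False
  then have N: "ou_norm u v > 0" using ou_norm_nonneg[of v] by simp
  have "inverse (ou_norm u v) *\<^sub>R v \<le> inverse (ou_norm u v) *\<^sub>R (ou_norm u v *\<^sub>R u)"
    using N le_ou_norm by (intro scaleR_left_mono) auto
  moreover have "0 \<le> inverse (ou_norm u v) *\<^sub>R v" using N assms by (intro scaleR_nonneg_nonneg) auto
  ultimately show ?thesis using N by simp
qed simp

text \<open>The definition normalizes by the norm; here every representation
  \<open>r *\<^sub>R a\<close> with \<open>a \<in> E\<close> gives the same result, so later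
  computations can choose the factor freely.\<close>

lemma cone_mult_scaled:
  assumes a: "a \<in> E" and r: "0 \<le> r"
  shows "cone_mult (r *\<^sub>R a) w = r *\<^sub>R extension a w"
proof -
  define v where "v = r *\<^sub>R a"
  define N where "N = ou_norm u v"
  define b where "b = inverse N *\<^sub>R v"
  have v0: "0 \<le> v" using a r by (simp add: v_def scaleR_nonneg_nonneg)
  have N0: "0 \<le> N" by (simp add: N_def ou_norm_nonneg)
  have b: "b \<in> E" unfolding b_def N_def by (rule normalize_in_E[OF v0])
  have vN: "v = N *\<^sub>R b"
    using ou_norm_eq_0[OF v0] by (cases "N = 0") (simp_all add: b_def N_def)
  \<comment> \<open>Dividing by a number at least as large as \<open>N\<close> and \<open>r\<close>
    brings both factors into the range of \<open>extension_scale\<close>; the 1 keeps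
    \<open>M\<close> positive when both vanish.\<close>
  define M where "M = max (max N r) 1"
  have M: "M > 0" "N \<le> M" "r \<le> M" by (auto simp: M_def)
  have "inverse M *\<^sub>R (N *\<^sub>R b) = inverse M *\<^sub>R (r *\<^sub>R a)"
    using vN by (simp only: v_def)
  then have "(N / M) *\<^sub>R b = (r / M) *\<^sub>R a"
    by (simp add: divide_inverse mult.commute)
  then have "extension ((N / M) *\<^sub>R b) w = extension ((r / M) *\<^sub>R a) w" by simp
  then have "(N / M) *\<^sub>R extension b w = (r / M) *\<^sub>R extension a w"
    using extension_scale[OF b, of "N / M"] extension_scale[OF a, of "r / M"] M N0 r by simp
  then have "M *\<^sub>R ((N / M) *\<^sub>R extension b w) = M *\<^sub>R ((r / M) *\<^sub>R extension a w)" by simp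
  then have "N *\<^sub>R extension b w = r *\<^sub>R extension a w" using M by simp
  then show ?thesis by (simp add: cone_mult_def v_def N_def b_def)
qed

lemma cone_mult_unscaled: "a \<in> E \<Longrightarrow> b \<in> E \<Longrightarrow> cone_mult a b = P a b"
  using cone_mult_scaled[of a 1 b] by (simp del: atLeastAtMost_iff add: extension_eq)

lemma cone_mult_scaled_both:
  assumes "a \<in> E" "b \<in> E" "0 \<le> r"
  shows "cone_mult (r *\<^sub>R a) (s *\<^sub>R b) = (r * s) *\<^sub>R P a b"
  using assms by (simp del: atLeastAtMost_iff add: cone_mult_scaled extension_eq linear_scale[OF extension_linear])

lemma cone_mult_linear:
  assumes "0 \<le> v" shows "linear (cone_mult v)"
proof -
  obtain r a where r: "r \<ge> 1" "a \<in> E" "v = r *\<^sub>R a" using nonneg_scale_unit_interval[OF assms] .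
  then have "cone_mult v = (\<lambda>w. r *\<^sub>R extension a w)" using cone_mult_scaled[OF r(2), of r] by auto
  then show ?thesis using linear_compose_scale_right[OF extension_linear[OF r(2)]] by simp
qed

lemma cone_mult_commute_iff:
  assumes "a \<in> E" "b \<in> E" "r \<ge> 1"
  shows "cone_mult (r *\<^sub>R a) (r *\<^sub>R b) = cone_mult (r *\<^sub>R b) (r *\<^sub>R a) \<longleftrightarrow> P a b = P b a"
  using assms(3) cone_mult_scaled_both[OF assms(1,2), of r r] cone_mult_scaled_both[OF assms(2,1), of r r] by simp

text \<open>The laws are scaled into \<open>E\<close> and read off from \<open>P\<close>; those with
  an arbitrary second argument hold because two linear maps that agree on \<open>E\<close>
  coincide.\<close>

sublocale cone: cone_product u cone_mult
proof (rule cone_product.intro[OF order_unit_space_axioms], rule cone_product_axioms.intro)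
  show "linear (cone_mult v)" if "0 \<le> v" for v by (rule cone_mult_linear[OF that])
next
  fix v w :: 'v assume v: "0 \<le> v" "0 \<le> w"
  obtain r a b c where r: "r \<ge> 1" "a \<in> E" "b \<in> E" "c \<in> E" "a + b \<in> E" "v = r *\<^sub>R a" "w = r *\<^sub>R b" "v = r *\<^sub>R c"
    using nonneg_common_scale[OF v v(1)] .
  then show "0 \<le> cone_mult v w" using nonneg[OF r(2,3)] cone_mult_scaled_both[OF r(2,3), of r r]
    by (simp add: scaleR_nonneg_nonneg)
next
  have "cone_mult u = (\<lambda>w. w)"
    by (rule linear_eq_on_interval)
      (simp_all del: atLeastAtMost_iff add: cone_mult_linear linear_id[unfolded id_def] cone_mult_unscaled unit_left)
  then show "cone_mult u w = w" for w by metis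
next
  fix v :: 'v assume v: "0 \<le> v"
  obtain r a where r: "r \<ge> 1" "a \<in> E" "v = r *\<^sub>R a" using nonneg_scale_unit_interval[OF v] .
  then show "cone_mult v u = v"
    using cone_mult_scaled[OF r(2), of r u] extension_eq[OF r(2) u_in_E] unit_right[OF r(2)] by simp
  fix t :: real and w assume t: "0 \<le> t"
  show "cone_mult (t *\<^sub>R v) w = t *\<^sub>R cone_mult v w"
    using cone_mult_scaled[OF r(2), of "t * r" w] cone_mult_scaled[OF r(2), of r w] r t by simp
next
  fix v w x :: 'v assume v: "0 \<le> v" "0 \<le> w" and comm: "cone_mult v w = cone_mult w v"
  obtain r a b c where r: "r \<ge> 1" "a \<in> E" "b \<in> E" "c \<in> E" "a + b \<in> E" "v = r *\<^sub>R a" "w = r *\<^sub>R b" "v = r *\<^sub>R c"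
    using nonneg_common_scale[OF v v(1)] .
  have "P a b = P b a" using comm cone_mult_commute_iff[OF r(2,3,1)] r by simp
  then have as: "P a (P b x) = P (P a b) x" if "x \<in> E" for x using assoc r that by blast
  have vw: "cone_mult v w = (r * r) *\<^sub>R P a b" using cone_mult_scaled_both[OF r(2,3), of r r] r by simp
  have Pab: "P a b \<in> E" using closed r by blast
  have "0 \<le> (r * r) *\<^sub>R P a b" using Pab by (intro scaleR_nonneg_nonneg) auto
  then have "(\<lambda>x. cone_mult v (cone_mult w x)) = cone_mult (cone_mult v w)"
  proof (intro linear_eq_on_interval)
    show "linear (\<lambda>x. cone_mult v (cone_mult w x))"
      using linear_compose[OF cone_mult_linear cone_mult_linear, OF v(2,1)] by (simp add: o_def)
    fix x assume x: "x \<in> E"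
    have "cone_mult v (cone_mult w x) = cone_mult (r *\<^sub>R a) (r *\<^sub>R P b x)"
      using cone_mult_scaled_both[OF r(3) x, of r 1] r by simp
    also have "\<dots> = (r * r) *\<^sub>R P (P a b) x"
      using cone_mult_scaled_both[OF r(2) closed[OF r(3) x], of r r] as[OF x] r by simp
    also have "\<dots> = cone_mult (cone_mult v w) x"
      unfolding vw using cone_mult_scaled_both[OF Pab x, of "r * r" 1] by simp
    finally show "cone_mult v (cone_mult w x) = cone_mult (cone_mult v w) x" .
  qed (auto intro: cone_mult_linear simp: vw)
  then show "cone_mult v (cone_mult w x) = cone_mult (cone_mult v w) x" by metis
next
  fix v w z :: 'v assume v: "0 \<le> v" "0 \<le> w" "0 \<le> z"
    and comm: "cone_mult z v = cone_mult v z" "cone_mult z w = cone_mult w z"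
  obtain r a b c where r: "r \<ge> 1" "a \<in> E" "b \<in> E" "c \<in> E" "a + b \<in> E" "v = r *\<^sub>R a" "w = r *\<^sub>R b" "z = r *\<^sub>R c"
    using nonneg_common_scale[OF v] .
  have c: "P c a = P a c" "P c b = P b c"
    using comm cone_mult_commute_iff[OF r(4,2,1)] cone_mult_commute_iff[OF r(4,3,1)] r by auto
  have Pab: "P a b \<in> E" using closed r by blast
  have vw: "cone_mult v w = (r * r) *\<^sub>R P a b" using cone_mult_scaled_both[OF r(2,3), of r r] r by simp
  show "cone_mult z (cone_mult v w) = cone_mult (cone_mult v w) z"
    unfolding vw using cone_mult_scaled_both[OF r(4) Pab, of r "r * r"]
      cone_mult_scaled_both[OF Pab r(4), of "r * r" r] comm_mult[OF r(2,3,4) c] r by (simp add: mult.commute)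
  show "cone_mult z (v + w) = cone_mult (v + w) z"
    using cone_mult_commute_iff[OF r(4,5,1)] comm_add[OF r(2,3,4,5) c] r by (simp add: scaleR_right_distrib)
next
  fix v w z :: 'v assume v: "0 \<le> w" "w \<le> v" "0 \<le> z"
    and comm: "cone_mult z v = cone_mult v z" "cone_mult z w = cone_mult w z"
  have "0 \<le> v" using v by auto
  then obtain r a b c where r: "r \<ge> 1" "a \<in> E" "b \<in> E" "c \<in> E" "a + b \<in> E" "v = r *\<^sub>R a" "w = r *\<^sub>R b" "z = r *\<^sub>R c"
    using nonneg_common_scale[OF _ v(1,3)] by metis
  have c: "P c a = P a c" "P c b = P b c"
    using comm cone_mult_commute_iff[OF r(4,2,1)] cone_mult_commute_iff[OF r(4,3,1)] r by auto
  have "inverse r *\<^sub>R w \<le> inverse r *\<^sub>R v" using v r by (intro scaleR_left_mono) auto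
  then have ba: "b \<le> a" using r by simp
  have "a - b \<le> a" using r(3) by simp
  then have "a - b \<le> u" using r(2) order_trans[of "a - b" a u] by auto
  then have abE: "a - b \<in> E" using ba by simp
  show "cone_mult z (v - w) = cone_mult (v - w) z"
    using cone_mult_commute_iff[OF r(4) abE r(1)] comm_diff[OF r(2,3,4) ba c] r by (simp add: scaleR_right_diff_distrib)
next
  fix X :: "nat \<Rightarrow> 'v" and x z :: 'v assume X: "\<And>n. 0 \<le> X n" "0 \<le> x" "conv X x" and z: "0 \<le> z"
  obtain s b where s: "s \<ge> 1" "b \<in> E" "z = s *\<^sub>R b" using nonneg_scale_unit_interval[OF z] .
  obtain t where t: "t > 0" "x \<le> t *\<^sub>R u" using order_unit_real by blast
  \<comment> \<open>From some index on \<open>X n \<le> x + u \<le> r *\<^sub>R u\<close>, so after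
    discarding finitely many terms and dividing by \<open>r\<close> the sequence lies in
    \<open>E\<close>.\<close>
  define r where "r = t + 1"
  have r: "r > 0" using t by (simp add: r_def)
  obtain N where N: "\<And>n. n \<ge> N \<Longrightarrow> X n - x \<le> 1 *\<^sub>R u" using convD[OF X(3), of 1] by auto
  have XE: "inverse r *\<^sub>R X (n + N) \<in> E" for n
  proof -
    have "X (n + N) \<le> x + 1 *\<^sub>R u" using N[of "n + N"] by (simp add: diff_le_eq add.commute)
    also have "\<dots> \<le> r *\<^sub>R u" using t by (simp add: r_def scaleR_left_distrib)
    finally have "inverse r *\<^sub>R X (n + N) \<le> inverse r *\<^sub>R (r *\<^sub>R u)" using r by (intro scaleR_left_mono) auto
    moreover have "0 \<le> inverse r *\<^sub>R X (n + N)" using r X by (intro scaleR_nonneg_nonneg) auto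
    ultimately show ?thesis using r by simp
  qed
  have xE: "inverse r *\<^sub>R x \<in> E"
  proof -
    have "x \<le> r *\<^sub>R u" using t by (simp add: r_def scaleR_left_distrib add_increasing2)
    then have "inverse r *\<^sub>R x \<le> inverse r *\<^sub>R (r *\<^sub>R u)" using r by (intro scaleR_left_mono) auto
    moreover have "0 \<le> inverse r *\<^sub>R x" using r X by (intro scaleR_nonneg_nonneg) auto
    ultimately show ?thesis using r by simp
  qed
  have "conv (\<lambda>n. inverse r *\<^sub>R X (n + N)) (inverse r *\<^sub>R x)"
    using r X(3) conv_offset[of X N x] by (intro conv_scale) auto
  then have "conv (\<lambda>n. P (inverse r *\<^sub>R X (n + N)) b) (P (inverse r *\<^sub>R x) b)"
    by (rule continuous[OF XE xE s(2)])
  then have "conv (\<lambda>n. (r * s) *\<^sub>R P (inverse r *\<^sub>R X (n + N)) b) ((r * s) *\<^sub>R P (inverse r *\<^sub>R x) b)"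
    using r s by (intro conv_scale) auto
  then have "conv (\<lambda>n. cone_mult (X (n + N)) z) (cone_mult x z)"
    using cone_mult_scaled_both[OF XE s(2), where r = r and s = s] cone_mult_scaled_both[OF xE s(2), of r s] r s(3) by simp
  then show "conv (\<lambda>n. cone_mult (X n) z) (cone_mult x z)"
    using conv_offset[of "\<lambda>n. cone_mult (X n) z" N] by simp
qed

end

section \<open>Transfer to the effect algebra\<close>

context associated_order_unit_space
begin

abbreviation "val \<equiv> inv \<phi>"

definition product :: "('e \<Rightarrow> 'e \<Rightarrow> 'e) \<Rightarrow> 'v \<Rightarrow> 'v \<Rightarrow> 'v" where
  "product sp a b = \<phi> (sp (val a) (val b))"

lemma \<phi>_E [simp]: "\<phi> x \<in> E"
  using iso_bij unfolding bij_betw_def by auto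

lemma inj_\<phi>: "inj \<phi>"
  using iso_bij unfolding bij_betw_def by blast

lemma val_\<phi> [simp]: "val (\<phi> x) = x"
  using inj_\<phi> by simp

lemma \<phi>_val: "a \<in> E \<Longrightarrow> \<phi> (val a) = a"
  using iso_bij unfolding bij_betw_def by (intro f_inv_into_f) auto

lemma \<phi>_eq_iff: "\<phi> x = \<phi> y \<longleftrightarrow> x = y"
  using inj_\<phi> by (auto dest: injD)

lemma val_oplus: "a \<in> E \<Longrightarrow> b \<in> E \<Longrightarrow> a + b \<in> E \<Longrightarrow> oplus (val a) (val b) = Some (val (a + b))"
  by (simp del: atLeastAtMost_iff add: iso_oplus \<phi>_val)

lemma ea_le_iff: "ea_le oplus x y \<longleftrightarrow> \<phi> x \<le> \<phi> y"
proof
  assume "ea_le oplus x y"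
  then obtain z where "\<phi> x + \<phi> z = \<phi> y" unfolding ea_le_def iso_oplus by blast
  moreover have "0 \<le> \<phi> z" using \<phi>_E[of z] by simp
  ultimately show "\<phi> x \<le> \<phi> y" by (metis le_add_same_cancel1)
next
  assume le: "\<phi> x \<le> \<phi> y"
  have "0 \<le> \<phi> x" "\<phi> y \<le> u" using \<phi>_E[of x] \<phi>_E[of y] by auto
  then have "\<phi> y - \<phi> x \<in> E" using le by (simp add: diff_le_eq add_increasing2)
  then have "\<phi> x + \<phi> (val (\<phi> y - \<phi> x)) = \<phi> y" by (simp add: \<phi>_val)
  then show "ea_le oplus x y" unfolding ea_le_def iso_oplus by blast
qed

lemma perp_val: assumes "a \<in> E" shows "ea_perp oplus one (val a) = val (u - a)"
  unfolding ea_perp_def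
proof (rule the_equality)
  show *: "oplus (val a) (val (u - a)) = Some one"
    using assms compl_in_E[OF assms] by (simp del: atLeastAtMost_iff add: iso_oplus iso_one \<phi>_val)
  show "y = val (u - a)" if "oplus (val a) y = Some one" for y
    using that * ex1_perp[of "val a"] by blast
qed

lemma val_one: "val u = one"
  using val_\<phi>[of one] by (simp add: iso_one)

lemma product_val: "val (product sp a b) = sp (val a) (val b)"
  by (simp add: product_def)

lemma product_\<phi>: "product sp (\<phi> x) (\<phi> y) = \<phi> (sp x y)"
  by (simp add: product_def)

lemma product_comm_iff: "product sp a b = product sp b a \<longleftrightarrow> commutes sp (val a) (val b)"
  by (simp add: product_def commutes_def \<phi>_eq_iff)

lemma ou_product_of_sequential_product:
  assumes "sequential_product oplus zero one sp"
  shows "ou_product u (product sp)"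
proof -
  interpret sp: sequential_product oplus zero one sp by fact
  show ?thesis
  proof (rule ou_product.intro[OF order_unit_space_axioms], rule ou_product_axioms.intro)
    show "product sp a b \<in> E" for a b by (simp del: atLeastAtMost_iff add: product_def)
    fix a b c :: 'v assume a: "a \<in> E"
    show "product sp u a = a" using a by (simp add: product_def val_one sp.sp_one_left \<phi>_val)
    assume b: "b \<in> E"
    show "product sp b a = 0" if "product sp a b = 0"
      using that sp.sp_zero_sym[of "val a" "val b"] iso_zero \<phi>_eq_iff unfolding product_def by metis
    show "product sp a (u - b) = product sp (u - b) a" if "product sp a b = product sp b a"
      using that sp.commutes_perp[of "val a" "val b"] b by (simp add: product_comm_iff perp_val)
    assume c: "c \<in> E"
    show "product sp a (b + c) = product sp a b + product sp a c" if "b + c \<in> E"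
      using sp.sp_additive[OF val_oplus[OF b c that], of "val a"] by (simp add: product_def iso_oplus)
    show "product sp a (product sp b c) = product sp (product sp a b) c"
      if "product sp a b = product sp b a"
      using that sp.commutes_assoc[of "val a" "val b" "val c"]
      unfolding product_comm_iff by (simp add: product_def)
    show "product sp c (product sp a b) = product sp (product sp a b) c"
      if "product sp c a = product sp a c" "product sp c b = product sp b c"
      using that sp.commutes_sp unfolding product_comm_iff product_val by blast
    show "product sp c (a + b) = product sp (a + b) c"
      if "a + b \<in> E" "product sp c a = product sp a c" "product sp c b = product sp b c"
      using that sp.commutes_oplus[OF _ _ val_oplus[OF a b that(1)], of "val c"] unfolding product_comm_iff by blast
  qed
qed

lemma descending_val:
  assumes "\<And>n. X n \<in> E" "decseq X" shows "ea_descending oplus (\<lambda>n. val (X n))"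
  unfolding ea_descending_def ea_le_iff \<phi>_val[OF assms(1)] using assms(2) by (simp add: decseq_Suc_iff)

lemma is_inf_val:
  assumes X: "\<And>n. X n \<in> E" and i: "is_inf X i"
  shows "i \<in> E" "ea_is_inf oplus (\<lambda>n. val (X n)) (val i)"
proof -
  have "0 \<le> i" using X by (intro is_inf_greatest[OF i]) auto
  moreover have "i \<le> u" using is_inf_lower[OF i, of 0] X[of 0] by (auto intro: order_trans)
  ultimately show iE: "i \<in> E" by simp
  show "ea_is_inf oplus (\<lambda>n. val (X n)) (val i)"
    unfolding ea_is_inf_def ea_le_iff \<phi>_val[OF X] \<phi>_val[OF iE] using i by (simp add: is_inf_def)
qed

text \<open>\<open>ea_is_inf\<close> compares with effects only; \<open>relative_inf_is_inf\<close>
  raises its infima to the infima in the whole space that \<open>normal_ou_product\<close> speaks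
  about.\<close>

lemma normal_ou_product_of_normal_sequential_product:
  assumes ses: "sequential_effect_space oplus zero one scale"
    and "normal_sequential_product oplus zero one sp"
  shows "normal_ou_product u (product sp)"
proof -
  interpret ses: sequential_effect_space oplus zero one scale by fact
  interpret sp: normal_sequential_product oplus zero one sp by fact
  interpret P: ou_product u "product sp"
    by (rule ou_product_of_sequential_product) (rule sp.sequential_product_axioms)
  have lower: "l \<le> \<phi> i" if "ea_is_inf oplus (\<lambda>n. val (Y n)) i" "\<And>n. Y n \<in> E" "l \<in> E" "\<And>n. l \<le> Y n" for Y i l
  proof -
    have "ea_le oplus (val l) (val (Y n))" for n using that by (simp del: atLeastAtMost_iff add: ea_le_iff \<phi>_val)
    then show ?thesis using that(1,3) unfolding ea_is_inf_def by (metis ea_le_iff \<phi>_val)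
  qed
  have bound: "\<phi> i \<le> Y n" if "ea_is_inf oplus (\<lambda>n. val (Y n)) i" "\<And>n. Y n \<in> E" for Y i n
    using that unfolding ea_is_inf_def ea_le_iff by (simp del: atLeastAtMost_iff add: \<phi>_val)
  have ex: "\<exists>j\<in>E. (\<forall>n. j \<le> Y n) \<and> (\<forall>l\<in>E. (\<forall>n. l \<le> Y n) \<longrightarrow> l \<le> j)"
    if Y: "\<And>n. Y n \<in> E" "decseq Y" for Y
  proof -
    obtain i where i: "ea_is_inf oplus (\<lambda>n. val (Y n)) i"
      using ses.ex_inf[OF descending_val[OF Y]] by blast
    show ?thesis
      by (rule bexI[OF _ \<phi>_E[of i]]) (use lower[OF i Y(1)] bound[OF i Y(1)] in blast)
  qed
  have inf: "is_inf Y (\<phi> i)" if "ea_is_inf oplus (\<lambda>n. val (Y n)) i" "\<And>n. Y n \<in> E" "decseq Y" for Y i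
    by (rule relative_inf_is_inf[OF ex that(2,3) \<phi>_E bound[OF that(1,2)] lower[OF that(1,2)]])
  show ?thesis
  proof (rule normal_ou_product.intro[OF P.ou_product_axioms], rule normal_ou_product_axioms.intro)
    fix X assume X: "\<And>n. X n \<in> E" "decseq X"
    show "\<exists>i. is_inf X i" using ses.ex_inf[OF descending_val[OF X]] inf[OF _ X] by blast
    fix i b assume i: "is_inf X i" and b: "b \<in> E"
    note iE = is_inf_val(1)[OF X(1) i] and ea = is_inf_val(2)[OF X(1) i]
    have PX: "product sp b (X n) \<in> E" for n by (rule P.closed[OF b X(1)])
    have "ea_is_inf oplus (\<lambda>n. val (product sp b (X n))) (sp (val b) (val i))"
      unfolding product_val by (rule sp.sp_inf[OF descending_val[OF X] ea])
    moreover have "decseq (\<lambda>n. product sp b (X n))"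
      unfolding decseq_Suc_iff using X(2) P.mono_right[OF b X(1) X(1)] by (simp add: decseq_Suc_iff)
    ultimately have "is_inf (\<lambda>n. product sp b (X n)) (\<phi> (sp (val b) (val i)))"
      by (intro inf PX)
    then show "is_inf (\<lambda>n. product sp b (X n)) (product sp b i)"
      by (simp only: product_def)
    assume "\<And>n. product sp b (X n) = product sp (X n) b"
    then show "product sp b i = product sp i b"
      unfolding product_comm_iff by (intro sp.commutes_inf[OF descending_val[OF X] ea]) simp
  qed
qed

text \<open>\<open>sp\<close> itself may fail to be normal: the digits come from the normal product
  \<open>sp0\<close>, and \<open>dyadic\<close> transfers since it mentions only the order.\<close>

lemma continuous_product_of_sequential_product:
  assumes ses: "sequential_effect_space oplus zero one scale"
    and sp: "sequential_product oplus zero one sp" and cont: "norm_continuous_first u \<phi> sp"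
  shows "continuous_product u (product sp)"
proof -
  interpret ses: sequential_effect_space oplus zero one scale by fact
  obtain sp0 where "normal_sequential_product oplus zero one sp0" using ses.ex_normal_sp by blast
  then interpret N: normal_ou_product u "product sp0"
    by (rule normal_ou_product_of_normal_sequential_product[OF ses])
  interpret P: ou_product u "product sp" by (rule ou_product_of_sequential_product[OF sp])
  show ?thesis
  proof (intro continuous_product.intro continuous_product_axioms.intro dyadic_product.intro
      dyadic_product_axioms.intro P.ou_product_axioms)
    show "dyadic a" if "a \<in> E" for a by (rule N.dyadic[OF that])
    fix X a b assume E: "\<And>n. X n \<in> E" "a \<in> E" "b \<in> E" and X: "conv X a"
    show "conv (\<lambda>n. product sp (X n) b) (product sp a b)"
      unfolding conv_def
    proof (intro allI impI)
      fix e :: real assume "e > 0"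
      then obtain d where d: "d > 0" "\<And>x. ou_norm u (\<phi> x - \<phi> (val a)) < d \<Longrightarrow>
          ou_norm u (\<phi> (sp x (val b)) - \<phi> (sp (val a) (val b))) < e"
        using cont unfolding norm_continuous_first_def by blast
      \<comment> \<open>\<open>ou_norm_le\<close> returns a non-strict bound, so half of
        \<open>d\<close> is used to stay strictly below \<open>d\<close>.\<close>
      obtain N where N: "\<And>n. n \<ge> N \<Longrightarrow> - ((d/2) *\<^sub>R u) \<le> X n - a \<and> X n - a \<le> (d/2) *\<^sub>R u"
        using convD[OF X, of "d/2"] d by auto
      show "\<exists>N. \<forall>n\<ge>N. - (e *\<^sub>R u) \<le> product sp (X n) b - product sp a b \<and>
          product sp (X n) b - product sp a b \<le> e *\<^sub>R u"
      proof (intro exI[of _ N] allI impI)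
        fix n assume "n \<ge> N"
        then have "ou_norm u (X n - a) \<le> d / 2" using N[of n] d by (intro ou_norm_le) auto
        then have "ou_norm u (\<phi> (val (X n)) - \<phi> (val a)) < d"
          using d(1) unfolding \<phi>_val[OF E(1)] \<phi>_val[OF E(2)] by linarith
        from d(2)[OF this] show "- (e *\<^sub>R u) \<le> product sp (X n) b - product sp a b \<and>
            product sp (X n) b - product sp a b \<le> e *\<^sub>R u"
          unfolding product_def using ou_norm_less_bounds by blast
      qed
    qed
  qed
qed

lemma vprod_eq_cone_mult:
  assumes P: "continuous_product u (product sp)" and v: "0 \<le> v"
  shows "vprod u \<phi> sp v = continuous_product.cone_mult u (product sp) v"
proof
  interpret P: continuous_product u "product sp" by fact
  fix w
  \<comment> \<open>\<open>\<phi>\<close> maps onto \<open>E\<close>, so both definite descriptions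
    single out the same linear map.\<close>
  have "(\<forall>b\<in>E. L b = product sp (\<phi> x) b) \<longleftrightarrow> (\<forall>b. L (\<phi> b) = \<phi> (sp x b))" for L x
    using \<phi>_val \<phi>_E product_\<phi> by metis
  then have "sp_ext \<phi> sp x = P.extension (\<phi> x)" for x
    unfolding sp_ext_def P.extension_def by simp
  then show "vprod u \<phi> sp v w = P.cone_mult v w"
    unfolding vprod_def P.cone_mult_def using \<phi>_val[OF P.normalize_in_E[OF v]] by simp
qed

text \<open>Uniqueness of inverses trades the definite description in \<open>sp_inverse\<close> for
  the relational form that \<open>agree\<close> takes.\<close>

lemma inverse_of_product:
  assumes P: "continuous_product u (product sp)" and pres: "invertibility_preserving u \<phi> sp"
    and nn: "0 \<le> a" "0 \<le> b"
    and inv: "cone_product.is_inverse u (continuous_product.cone_mult u (product sp)) a c"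
      "cone_product.is_inverse u (continuous_product.cone_mult u (product sp)) b d"
  shows "cone_product.is_inverse u (continuous_product.cone_mult u (product sp))
    (continuous_product.cone_mult u (product sp) a b) (continuous_product.cone_mult u (product sp) c d)"
proof -
  interpret P: continuous_product u "product sp" by fact
  have inv_iff: "is_sp_inverse u \<phi> sp x y \<longleftrightarrow> P.cone.is_inverse x y" if "0 \<le> x" for x y
    unfolding is_sp_inverse_def P.cone.is_inverse_def
    using vprod_eq_cone_mult[OF P that] vprod_eq_cone_mult[OF P, of y] by metis
  have inverse: "sp_inverse u \<phi> sp x = y" if "0 \<le> x" "P.cone.is_inverse x y" for x y
    unfolding sp_inverse_def inv_iff[OF that(1)]
    using that P.cone.is_inverse_unique[OF that(1)] by (intro the_equality) blast+
  have invertible: "sp_invertible u \<phi> sp x \<longleftrightarrow> 0 \<le> x \<and> (\<exists>y. P.cone.is_inverse x y)" for x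
    unfolding sp_invertible_def using inv_iff by blast
  have cd: "0 \<le> c" "0 \<le> d" using inv by (auto simp: P.cone.is_inverse_def)
  have ab: "0 \<le> P.cone_mult a b" by (rule P.cone.nonneg[OF nn])
  have "sp_invertible u \<phi> sp a" "sp_invertible u \<phi> sp b" using nn inv invertible by blast+
  then have "sp_invertible u \<phi> sp (vprod u \<phi> sp a b) \<and> sp_inverse u \<phi> sp (vprod u \<phi> sp a b) =
      vprod u \<phi> sp (sp_inverse u \<phi> sp a) (sp_inverse u \<phi> sp b)"
    using pres unfolding invertibility_preserving_def by blast
  then have *: "sp_invertible u \<phi> sp (P.cone_mult a b)" "sp_inverse u \<phi> sp (P.cone_mult a b) = P.cone_mult c d"
    unfolding inverse[OF nn(1) inv(1)] inverse[OF nn(2) inv(2)] vprod_eq_cone_mult[OF P nn(1)]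
      vprod_eq_cone_mult[OF P cd(1)] by blast+
  then obtain y where "P.cone.is_inverse (P.cone_mult a b) y" using invertible by blast
  then show ?thesis using inverse[OF ab] *(2) by metis
qed

lemma invariant_cone_mult:
  assumes P: "continuous_product u (product sp)" and inv: "invariant_sp u \<phi> sp"
    and \<Phi>: "unital_order_iso u \<Phi>" and v: "0 \<le> v" "0 \<le> w"
  shows "\<Phi> (continuous_product.cone_mult u (product sp) v w) =
    continuous_product.cone_mult u (product sp) (\<Phi> v) (\<Phi> w)"
proof -
  interpret P: continuous_product u "product sp" by fact
  have lin: "linear \<Phi>" using \<Phi> by (simp add: unital_order_iso_def)
  have \<Phi>E: "\<Phi> a \<in> E" if "a \<in> E" for a
  proof -
    have "0 \<le> \<Phi> a" "0 \<le> \<Phi> (u - a)" using \<Phi> that unfolding unital_order_iso_def by auto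
    then show ?thesis using \<Phi> by (simp add: linear_diff[OF lin] unital_order_iso_def)
  qed
  obtain r a where r: "r \<ge> 1" "a \<in> E" "v = r *\<^sub>R a" using nonneg_scale_unit_interval[OF v(1)] .
  obtain s b where s: "s \<ge> 1" "b \<in> E" "w = s *\<^sub>R b" using nonneg_scale_unit_interval[OF v(2)] .
  have "\<Phi> (product sp a b) = product sp (\<Phi> a) (\<Phi> b)"
    using inv \<Phi> \<phi>_val[OF r(2)] \<phi>_val[OF s(2)] unfolding invariant_sp_def product_def by metis
  then show ?thesis
    using P.cone_mult_scaled_both[OF r(2) s(2), of r s] P.cone_mult_scaled_both[OF \<Phi>E[OF r(2)] \<Phi>E[OF s(2)], of r s] r s
    by (simp add: linear_scale[OF lin])
qed

end

theorem theorem5p19: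
  fixes oplus :: "'e \<Rightarrow> 'e \<Rightarrow> 'e option" and zero one :: 'e
    and scale :: "real \<Rightarrow> 'e \<Rightarrow> 'e"
    and u :: "'v::ordered_real_vector" and \<phi> :: "'e \<Rightarrow> 'v"
    and sp sp' :: "'e \<Rightarrow> 'e \<Rightarrow> 'e"
  assumes "sequential_effect_space oplus zero one scale"
    and "associated_order_unit_space oplus zero one scale u \<phi>"
    and "sequential_product oplus zero one sp"
    and "invariant_sp u \<phi> sp"
    and "invertibility_preserving u \<phi> sp"
    and "norm_continuous_first u \<phi> sp"
    and "sequential_product oplus zero one sp'"
    and "invertibility_preserving u \<phi> sp'"
    and "norm_continuous_first u \<phi> sp'"
  shows "sp = sp'"
proof -
  interpret ses: sequential_effect_space oplus zero one scale by fact
  interpret A: associated_order_unit_space oplus zero one scale u \<phi> by fact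
  note P = A.continuous_product_of_sequential_product[OF assms(1,3,6)]
  note Q = A.continuous_product_of_sequential_product[OF assms(1,7,9)]
  interpret P: continuous_product u "A.product sp" by (rule P)
  interpret Q: continuous_product u "A.product sp'" by (rule Q)
  \<comment> \<open>The normal product returns once more, now for the norm limits behind
    \<open>geometric_conv\<close>.\<close>
  obtain sp0 where "normal_sequential_product oplus zero one sp0" using ses.ex_normal_sp by blast
  then interpret N: normal_ou_product u "A.product sp0"
    by (rule A.normal_ou_product_of_normal_sequential_product[OF assms(1)])
  interpret pair: cone_product_pair u P.cone_mult Q.cone_mult
  proof (intro cone_product_pair.intro cone_product_pair_axioms.intro P.cone.cone_product_axioms Q.cone.cone_product_axioms)
    fix a :: 'v assume "0 \<le> a"
    then obtain r b where r: "r \<ge> 1" "b \<in> {0..u}" "a = r *\<^sub>R b" by (rule A.nonneg_scale_unit_interval)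
    then show "P.cone_mult a a = Q.cone_mult a a"
      using P.cone_mult_scaled_both[OF r(2,2), of r r] Q.cone_mult_scaled_both[OF r(2,2), of r r]
        squares_agree[OF P Q r(2)] by simp
  qed (rule N.geometric_conv)
  have "P.cone_mult a w = Q.cone_mult a w" if "0 \<le> a" "0 \<le> w" for a w
    by (rule pair.agree[OF A.invariant_cone_mult[OF P assms(4)] A.inverse_of_product[OF P assms(5)]
          A.inverse_of_product[OF Q assms(8)] that])
  then have "A.product sp (\<phi> x) (\<phi> y) = A.product sp' (\<phi> x) (\<phi> y)" for x y
    using P.cone_mult_unscaled Q.cone_mult_unscaled A.\<phi>_E by (metis atLeastAtMost_iff)
  then have "sp x y = sp' x y" for x y by (simp add: A.product_\<phi> A.\<phi>_eq_iff)
  then show ?thesis by blast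
qed

end
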